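(* (Jacobi's ratio theorem for the quantum Berezinian.) Let $M$ be the generator matrix of $\widetilde{\mathcal{M}}_{m|n}$. Let $I=\{i_1<\cdots<i_k\}$ be a subset of $[m+n]$ and $I^c=\{i_{k+1}<\cdots<i_{m+n}\}$ its complement in $[m+n]$. If $I$ satisfies one of the conditions (i) $I\subseteq[m]$; (ii) $[m]\subseteq I$, then $$\mathrm{Ber}_q(M)=\mathrm{Ber}_q(M_I)\,\mathrm{Ber}_{q^{-1}}\big(((M^{-1})_{I^c})^{\Pi\circ st}\big).$$
   Context: Let $q$ be a nonzero parameter, $m,n\ge0$ integers, $[k]=\{1,\dots,k\}$. An index $i\in[m+n]$ has parity $\bar i=0$ if $i\le m$ and $\bar i=1$ if $i>m$. Put $\varepsilon(a)=1,0,-1$ according to $a>0,a=0,a<0$. $l(\sigma)$ is the number of inversions of a permutation. A matrix $A=(A_{ij})_{i,j\in[m+n]}$ over a superalgebra, $A_{ij}$ of parity $\bar i+\bar j$, satisfies the relations $R^q$ (is a $q$-super Manin matrix of type $m|n$) if: (1) $A_{ij}^2=0$ if $\bar i=1,\bar j=0$; (2) $A_{ik}A_{il}=q^{\varepsilon(l-k)}(-1)^{(\bar k+1)(\bar l+1)}A_{il}A_{ik}$ if $\bar i=1$; (3) $A_{ik}A_{jk}=q^{\varepsilon(i-j)}(-1)^{\bar i\bar j}A_{jk}A_{ik}$ if $\bar k=0$; (4) for all $i,j,k,l$: $A_{ij}A_{kl}-q^{\varepsilon(i-k)+\varepsilon(l-j)}(-1)^{(\bar i+\bar j)(\bar k+\bar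 l)}A_{kl}A_{ij}=q^{\varepsilon(i-k)}(-1)^{\bar i\bar k+\bar j\bar k+\bar i\bar j}A_{kj}A_{il}-q^{\varepsilon(l-j)}(-1)^{\bar j\bar k+\bar j\bar l+\bar k\bar l}A_{il}A_{kj}$. The supertranspose is $(A^{st})_{ij}=(-1)^{\bar i(\bar i+\bar j)}A_{ji}$. $\widetilde{\mathcal{M}}_{m|n}$ is the unital associative superalgebra generated by the entries of two matrices $M$ and $M^{-1}$ ($(i,j)$ entries of parity $\bar i+\bar j$) subject to: $M$ satisfies $R^q$; $M^{-1}$ satisfies $R^{q^{-1}}$ (i.e. $R^q$ with $q$ replaced by $q^{-1}$); $MM^{-1}=M^{-1}M=1$; and $M^{st}(M^{-1})^{st}=(M^{-1})^{st}M^{st}=1$. Berezinians. Let $A$ be a matrix of type $r|s$ (first $r$ indices even, last $s$ odd). Then $$\mathrm{Ber}_q(A)=\sum_{\sigma\in\mathfrak{S}_r}(-q)^{-l(\sigma)}A_{\sigma(1),1}\cdots A_{\sigma(r),r}\times\sum_{\rho\in\mathfrak{S}_s}(-q)^{-l(\rho)}(A^{-1})_{r+1,r+\rho(1)}\cdots(A^{-1})_{r+s,r+\rho(s)},$$ $$\mathrm{Ber}_q(A^{\Pi\circ st})=\sum_{\rho\in\mathfrak{S}_s}(-q)^{-l(\rho)}A_{r+s,r+\rho(s)}\cdots A_{r+1,r+\rho(1)}\times\sum_{\sigma\in\mathfrak{S}_r}(-q)^{-l(\sigma)}(A^{-1})_{\sigma(r),r}\cdots(A^{-1})_{\sigma(1),1},$$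 where $(A^\Pi)_{ij}=A_{r+s+1-i,r+s+1-j}$ and $A^{\Pi\circ st}=(A^\Pi)^{st}$ (a matrix of type $s|r$); empty sums/products over $\mathfrak{S}_0$ equal $1$. $\mathrm{Ber}_{q^{-1}}$ is given by the same formulas with $q$ replaced by $q^{-1}$. For a subset $I$ of $[m+n]$ with $r$ elements in $[m]$ and $s$ outside, $M_I$ (resp. $(M^{-1})_I$) is the submatrix of $M$ (resp. $M^{-1}$) with row and column indices in $I$, taken in increasing order; it is a matrix of type $r|s$. Standing conventions: all inverses of submatrices, quasideterminants and Berezinians that are needed are assumed to exist (in a suitable extension of $\widetilde{\mathcal{M}}_{m|n}$), and $M_I$ together with its inverse is regarded as the generator matrix of $\widetilde{\mathcal{M}}_{r|s}$ together with its antipode image (i.e. they satisfy the defining relations of $\widetilde{\mathcal{M}}_{r|s}$); likewise for $(M^{-1})_I$ with $q$ replaced by $q^{-1}$. *)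

theory Defs
  imports
    "HOL-Combinatorics.Permutations"
    "Jordan_Normal_Form.Matrix"
    "Jordan_Normal_Form.DL_Submatrix"
begin

text \<open>
  Matrices are 0-indexed: the index set \<open>[m+n]\<close> is \<open>{..<m+n}\<close>, and \<open>[m]\<close> is \<open>{..<m}\<close>.
\<close>

locale superalgebra = vector_space scale
  for scale :: "'k::field \<Rightarrow> 'a::ring_1 \<Rightarrow> 'a" +
  fixes G :: "nat \<Rightarrow> 'a set"
  assumes scale_mult_left: "scale c x * y = scale c (x * y)"
    and scale_mult_right: "x * scale c y = scale c (x * y)"
    and subspace_even: "subspace (G 0)"
    and subspace_odd: "subspace (G 1)"
    and even_odd_disjoint: "G 0 \<inter> G 1 = {0}"
    and even_odd_span: "\<exists>y\<in>G 0. \<exists>z\<in>G 1. x = y + z"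
    and one_even: "1 \<in> G 0"
    and mult_parity: "\<lbrakk>a \<le> 1; b \<le> 1; x \<in> G a; y \<in> G b\<rbrakk> \<Longrightarrow> x * y \<in> G ((a + b) mod 2)"

definition parity :: "nat \<Rightarrow> nat \<Rightarrow> nat"
  where "parity m i = (if i < m then 0 else 1)"

definition eps :: "nat \<Rightarrow> nat \<Rightarrow> int"
  where "eps i j = sgn (int i - int j)"

definition super_manin ::
    "('k::field \<Rightarrow> 'a::ring_1 \<Rightarrow> 'a) \<Rightarrow> (nat \<Rightarrow> 'a set) \<Rightarrow> 'k \<Rightarrow> nat \<Rightarrow> nat \<Rightarrow> 'a mat \<Rightarrow> bool"
  where "super_manin scale G q m n A \<longleftrightarrow>
    A \<in> carrier_mat (m + n) (m + n) \<and>
    (\<forall>i<m+n. \<forall>j<m+n. A $$ (i,j) \<in> G ((parity m i + parity m j) mod 2)) \<and>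
    (\<forall>i<m+n. \<forall>j<m+n. parity m i = 1 \<and> parity m j = 0 \<longrightarrow> A $$ (i,j) ^ 2 = 0) \<and>
    (\<forall>i<m+n. \<forall>k<m+n. \<forall>l<m+n. parity m i = 1 \<longrightarrow>
      A $$ (i,k) * A $$ (i,l) =
        scale (q powi eps l k * (-1) ^ ((parity m k + 1) * (parity m l + 1)))
          (A $$ (i,l) * A $$ (i,k))) \<and>
    (\<forall>i<m+n. \<forall>j<m+n. \<forall>k<m+n. parity m k = 0 \<longrightarrow>
      A $$ (i,k) * A $$ (j,k) =
        scale (q powi eps i j * (-1) ^ (parity m i * parity m j))
          (A $$ (j,k) * A $$ (i,k))) \<and>
    (\<forall>i<m+n. \<forall>j<m+n. \<forall>k<m+n. \<forall>l<m+n.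
      A $$ (i,j) * A $$ (k,l)
        - scale (q powi (eps i k + eps l j)
              * (-1) ^ ((parity m i + parity m j) * (parity m k + parity m l)))
            (A $$ (k,l) * A $$ (i,j))
      = scale (q powi eps i k
              * (-1) ^ (parity m i * parity m k + parity m j * parity m k
                        + parity m i * parity m j))
            (A $$ (k,j) * A $$ (i,l))
        - scale (q powi eps l j
              * (-1) ^ (parity m j * parity m k + parity m j * parity m l
                        + parity m k * parity m l))
            (A $$ (i,l) * A $$ (k,j)))"

definition supertranspose :: "nat \<Rightarrow> 'a::ring_1 mat \<Rightarrow> 'a mat"
  where "supertranspose m A = mat (dim_col A) (dim_row A)
    (\<lambda>(i,j). (-1) ^ (parity m i * (parity m i + parity m j)) * A $$ (j,i))"

text \<open>The operation \<open>A \<mapsto> A\<^sup>\<Pi>\<close>; it turns a matrix of type \<open>r|s\<close> into one of type \<open>s|r\<close>.\<close>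

definition flip_mat :: "'a mat \<Rightarrow> 'a mat"
  where "flip_mat A = mat (dim_row A) (dim_col A)
    (\<lambda>(i,j). A $$ (dim_row A - 1 - i, dim_col A - 1 - j))"

text \<open>The two-sided inverse; only meaningful if one exists, and then it is unique.\<close>

definition minv :: "'a::ring_1 mat \<Rightarrow> 'a mat"
  where "minv A = (THE B. inverts_mat A B \<and> inverts_mat B A)"

text \<open>
  \<open>generator_matrix scale G q m n M\<close>: the entries of \<open>M\<close> and of its inverse satisfy the
  defining relations of the superalgebra \<open>\<M>\<^sub>m\<^sub>|\<^sub>n\<close> presented by these relations (parameter
  \<open>q\<close>), inside an arbitrary superalgebra. By the universal property of the presentation this says
  that \<open>M\<close> is the image of the generator matrix under a homomorphism of superalgebras; this
  includes the generator matrix itself, viewed in any extension of \<open>\<M>\<^sub>m\<^sub>|\<^sub>n\<close>.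
\<close>

definition generator_matrix ::
    "('k::field \<Rightarrow> 'a::ring_1 \<Rightarrow> 'a) \<Rightarrow> (nat \<Rightarrow> 'a set) \<Rightarrow> 'k \<Rightarrow> nat \<Rightarrow> nat \<Rightarrow> 'a mat \<Rightarrow> bool"
  where "generator_matrix scale G q m n M \<longleftrightarrow>
    super_manin scale G q m n M \<and>
    super_manin scale G (inverse q) m n (minv M) \<and>
    inverts_mat M (minv M) \<and> inverts_mat (minv M) M \<and>
    inverts_mat (supertranspose m M) (supertranspose m (minv M)) \<and>
    inverts_mat (supertranspose m (minv M)) (supertranspose m M)"

definition n_inversions :: "nat \<Rightarrow> (nat \<Rightarrow> nat) \<Rightarrow> nat"
  where "n_inversions r \<sigma> = card {(i,j). i < j \<and> j < r \<and> \<sigma> j < \<sigma> i}"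

definition Ber ::
    "('k::field \<Rightarrow> 'a::ring_1 \<Rightarrow> 'a) \<Rightarrow> 'k \<Rightarrow> nat \<Rightarrow> nat \<Rightarrow> 'a mat \<Rightarrow> 'a"
  where "Ber scale q r s A =
    (\<Sum>\<sigma> | \<sigma> permutes {..<r}. scale ((- q) powi (- int (n_inversions r \<sigma>)))
        (prod_list (map (\<lambda>j. A $$ (\<sigma> j, j)) [0..<r])))
    * (\<Sum>\<rho> | \<rho> permutes {..<s}. scale ((- q) powi (- int (n_inversions s \<rho>)))
        (prod_list (map (\<lambda>i. minv A $$ (r + i, r + \<rho> i)) [0..<s])))"

definition n_even :: "nat \<Rightarrow> nat set \<Rightarrow> nat"
  where "n_even m I = card (I \<inter> {..<m})"

definition n_odd :: "nat \<Rightarrow> nat set \<Rightarrow> nat"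
  where "n_odd m I = card (I - {..<m})"

text \<open>
  The standing convention on submatrices, for an index set \<open>I\<close> with complement \<open>I\<^sup>c\<close>: the
  submatrices \<open>M\<^sub>I\<close> and \<open>(M\<inverse>)\<^bsub>I\<^sup>c\<^esub>\<close> have inverses, and together with these they satisfy the
  relations of the generator matrix of the appropriate type, with parameters \<open>q\<close> and \<open>q\<inverse>\<close>.
\<close>

definition regular_at ::
    "('k::field \<Rightarrow> 'a::ring_1 \<Rightarrow> 'a) \<Rightarrow> (nat \<Rightarrow> 'a set) \<Rightarrow> 'k \<Rightarrow> nat \<Rightarrow> nat \<Rightarrow> 'a mat
      \<Rightarrow> nat set \<Rightarrow> bool"
  where "regular_at scale G q m n M I \<longleftrightarrow>
    (let J = {..<m+n} - I in
      generator_matrix scale G q (n_even m I) (n_odd m I) (submatrix M I I) \<and>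
      generator_matrix scale G (inverse q) (n_even m J) (n_odd m J) (submatrix (minv M) J J))"


lemma minv_eqI:
  assumes "inverts_mat A B" and "inverts_mat B A"
  shows "minv A = B"
proof -
  have dims: "dim_col C = dim_row A" "dim_row C = dim_col A"
    if h: "inverts_mat A C" "inverts_mat C A" for C
    using arg_cong[OF h(1)[unfolded inverts_mat_def], of dim_col]
      arg_cong[OF h(2)[unfolded inverts_mat_def], of dim_col] by simp_all
  have uniq: "B' = B" if h: "inverts_mat A B'" "inverts_mat B' A" for B'
  proof -
    have B: "B \<in> carrier_mat (dim_col A) (dim_row A)"
      and B': "B' \<in> carrier_mat (dim_col A) (dim_row A)"
      using dims[OF assms] dims[OF h] by auto
    have "B' = B' * 1\<^sub>m (dim_row A)"
      by (rule right_mult_one_mat[OF B', symmetric])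
    also have "\<dots> = B' * (A * B)"
      using assms(1) by (simp add: inverts_mat_def)
    also have "\<dots> = (B' * A) * B"
      by (rule assoc_mult_mat[OF B' _ B, symmetric]) simp
    also have "\<dots> = 1\<^sub>m (dim_col A) * B"
      using h(2) B' by (simp add: inverts_mat_def)
    also have "\<dots> = B"
      by (rule left_mult_one_mat[OF B])
    finally show ?thesis .
  qed
  show ?thesis unfolding minv_def by (rule the_equality) (blast intro: assms uniq)+
qed

lemma supertranspose_flip_inverts:
  fixes A B :: "'a::ring_1 mat"
  assumes A: "A \<in> carrier_mat (r + s) (r + s)" and B: "B \<in> carrier_mat (r + s) (r + s)"
    and inv: "inverts_mat (supertranspose r A) (supertranspose r B)"
  shows "inverts_mat (supertranspose s (flip_mat A)) (supertranspose s (flip_mat B))"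
proof -
  define N where "N = r + s"
  define w where "w = (\<lambda>i. N - 1 - i)"
  have dim: "dim_row A = N" "dim_col A = N" "dim_row B = N" "dim_col B = N"
    using A B by (auto simp: N_def)
  have w_lt: "w i < N" if "i < N" for i using that by (auto simp: w_def)
  have w_w: "w (w i) = i" if "i < N" for i using that by (auto simp: w_def)
  have bij: "bij_betw w {0..<N} {0..<N}"
    by (rule bij_betw_byWitness[where f' = w]) (auto simp: w_w w_lt)
  have par: "parity s i = 1 - parity r (w i)" if "i < N" for i
    using that by (auto simp: parity_def w_def N_def)
  have sgn: "(-1) ^ (parity s i * (parity s i + parity s j))
      = (-1) ^ (parity r (w i) + parity r (w j))
        * ((-1) ^ (parity r (w i) * (parity r (w i) + parity r (w j))) :: 'a)"
    if "i < N" "j < N" for i j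
    using par[OF that(1)] par[OF that(2)] by (auto simp: parity_def)
  have ent: "supertranspose s (flip_mat C) $$ (i,j)
      = (-1) ^ (parity r (w i) + parity r (w j)) * supertranspose r C $$ (w i, w j)"
    if "i < N" "j < N" "dim_row C = N" "dim_col C = N" for i j and C :: "'a mat"
  proof -
    have "flip_mat C $$ (j,i) = C $$ (w j, w i)"
      using that by (simp add: flip_mat_def w_def)
    moreover have "dim_row (flip_mat C) = N" "dim_col (flip_mat C) = N"
      using that by (auto simp: flip_mat_def)
    ultimately show ?thesis
      using that w_lt[OF that(1)] w_lt[OF that(2)]
      by (simp add: supertranspose_def sgn mult.assoc)
  qed
  have one: "(supertranspose r A * supertranspose r B) $$ (i,j) = (if i = j then 1 else 0)"
    if "i < N" "j < N" for i j
    using inv that dim by (auto simp: inverts_mat_def supertranspose_def)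
  have prd: "(\<Sum>k = 0..<N. supertranspose r A $$ (i,k) * supertranspose r B $$ (k,j))
      = (if i = j then 1 else 0)" if "i < N" "j < N" for i j
    using one[OF that] that dim by (simp add: supertranspose_def scalar_prod_def)
  have signs: "(-1) ^ (a + b) * x * ((-1) ^ (b + c) * y) = (-1) ^ (a + c) * (x * y)"
    for a b c :: nat and x y :: 'a
    by (cases "even a"; cases "even b"; cases "even c") (auto simp: power_add)
  have "(\<Sum>k = 0..<N. supertranspose s (flip_mat A) $$ (i,k) * supertranspose s (flip_mat B) $$ (k,j))
      = (if i = j then 1 else 0)" if ij: "i < N" "j < N" for i j
  proof -
    have "(\<Sum>k = 0..<N. supertranspose s (flip_mat A) $$ (i,k) * supertranspose s (flip_mat B) $$ (k,j))
      = (\<Sum>k = 0..<N. (-1) ^ (parity r (w i) + parity r (w j))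
          * (supertranspose r A $$ (w i, w k) * supertranspose r B $$ (w k, w j)))"
      by (rule sum.cong) (use ij dim in \<open>auto simp: ent signs\<close>)
    also have "\<dots> = (-1) ^ (parity r (w i) + parity r (w j))
        * (\<Sum>k = 0..<N. supertranspose r A $$ (w i, k) * supertranspose r B $$ (k, w j))"
      unfolding sum_distrib_left[symmetric]
      by (subst sum.reindex_bij_betw[OF bij]) simp
    also have "\<dots> = (-1) ^ (parity r (w i) + parity r (w j)) * (if i = j then 1 else 0)"
    proof -
      have "w i = w j \<longleftrightarrow> i = j"
        using ij by (auto simp: w_def)
      then show ?thesis
        by (simp only: prd[OF w_lt[OF ij(1)] w_lt[OF ij(2)]])
    qed
    also have "\<dots> = (if i = j then 1 else 0)"
      by simp
    finally show ?thesis .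
  qed
  then show ?thesis
    unfolding inverts_mat_def using dim
    by (intro eq_matI) (auto simp: supertranspose_def flip_mat_def scalar_prod_def)
qed

lemma sum_permutes_rev:
  fixes F :: "nat \<Rightarrow> (nat \<Rightarrow> nat) \<Rightarrow> 'b::comm_monoid_add"
  shows "(\<Sum>\<sigma> | \<sigma> permutes {..<r}. F (n_inversions r \<sigma>) \<sigma>)
    = (\<Sum>\<sigma> | \<sigma> permutes {..<r}. F (n_inversions r \<sigma>)
        (\<lambda>i. if i < r then r - 1 - \<sigma> (r - 1 - i) else i))"
proof -
  define w where "w = (\<lambda>i. r - 1 - i)"
  define c where "c = (\<lambda>\<sigma> i. if i < r then w (\<sigma> (w i)) else i)"
  have w_lt: "w i < r" if "i < r" for i using that by (auto simp: w_def)
  have w_w: "w (w i) = i" if "i < r" for i using that by (auto simp: w_def)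
  have lt: "\<sigma> i < r" if "\<sigma> permutes {..<r}" "i < r" for \<sigma> i
    using permutes_in_image[OF that(1), of i] that(2) by auto
  have cp: "c \<sigma> permutes {..<r}" if p: "\<sigma> permutes {..<r}" for \<sigma>
  proof (rule bij_imp_permutes)
    have "Hilbert_Choice.inv \<sigma> permutes {..<r}" using p by (rule permutes_inv)
    then show "bij_betw (c \<sigma>) {..<r} {..<r}"
      by (intro bij_betw_byWitness[where f' = "c (Hilbert_Choice.inv \<sigma>)"])
         (auto simp: c_def w_w w_lt lt[OF p] lt permutes_inverses[OF p])
  qed (auto simp: c_def)
  have cc: "c (c \<sigma>) = \<sigma>" if p: "\<sigma> permutes {..<r}" for \<sigma>
  proof
    fix i show "c (c \<sigma>) i = \<sigma> i"
      using permutes_not_in[OF p, of i] by (auto simp: c_def w_w w_lt lt[OF p])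
  qed
  have n_inv: "n_inversions r (c \<sigma>) = n_inversions r \<sigma>" if p: "\<sigma> permutes {..<r}" for \<sigma>
  proof -
    define g where "g = (\<lambda>(i,j). (w j, w i))"
    define S where "S = (\<lambda>\<tau>. {(i,j). i < j \<and> j < r \<and> \<tau> j < (\<tau> i :: nat)})"
    have w_less: "w i < w j \<longleftrightarrow> j < i" if "i < r" "j < r" for i j
      using that by (auto simp: w_def)
    have c_less: "c \<sigma> j < c \<sigma> i \<longleftrightarrow> \<sigma> (w i) < \<sigma> (w j)" if "i < r" "j < r" for i j
      using that by (simp add: c_def w_less lt[OF p] w_lt)
    have gS: "g (i,j) \<in> S \<sigma>" if "(i,j) \<in> S (c \<sigma>)" for i j
      using that w_less[of j i] w_lt[of i] c_less[of i j] by (auto simp: S_def g_def)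
    have gS': "g (i,j) \<in> S (c \<sigma>)" if "(i,j) \<in> S \<sigma>" for i j
      using that w_less[of j i] w_lt[of i] w_lt[of j] c_less[of "w j" "w i"] w_w[of i] w_w[of j]
      by (auto simp: S_def g_def)
    have gg: "g (g (i,j)) = (i,j)" if "i < j" "j < r" for i j
      using that w_w[of i] w_w[of j] by (simp add: g_def)
    have "bij_betw g (S (c \<sigma>)) (S \<sigma>)"
    proof (rule bij_betw_byWitness[where f' = g])
      show "\<forall>x\<in>S (c \<sigma>). g (g x) = x" "\<forall>x\<in>S \<sigma>. g (g x) = x"
        using gg by (auto simp: S_def)
      show "g ` S (c \<sigma>) \<subseteq> S \<sigma>" "g ` S \<sigma> \<subseteq> S (c \<sigma>)"
        using gS gS' by auto
    qed
    then have "card (S (c \<sigma>)) = card (S \<sigma>)" by (rule bij_betw_same_card)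
    then show ?thesis by (simp add: n_inversions_def S_def)
  qed
  have "(\<Sum>\<sigma> | \<sigma> permutes {..<r}. F (n_inversions r \<sigma>) \<sigma>)
      = (\<Sum>\<sigma> | \<sigma> permutes {..<r}. F (n_inversions r \<sigma>) (c \<sigma>))"
    by (rule sum.reindex_bij_witness[where i = c and j = c]) (auto simp: cp cc n_inv)
  then show ?thesis unfolding c_def w_def .
qed

text \<open>
  The closed formula for the Berezinian of \<open>(A\<^sup>\<Pi>)\<^sup>s\<^sup>t\<close>, in terms of \<open>A\<close> and its inverse.
\<close>

lemma Ber_supertranspose_flip:
  fixes A :: "'a::ring_1 mat"
  assumes gen: "generator_matrix scale G q' r s A"
  shows "Ber scale q s r (supertranspose s (flip_mat A)) =
    (\<Sum>\<rho> | \<rho> permutes {..<s}. scale ((- q) powi (- int (n_inversions s \<rho>)))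
        (prod_list (map (\<lambda>i. A $$ (r + i, r + \<rho> i)) (rev [0..<s]))))
    * (\<Sum>\<sigma> | \<sigma> permutes {..<r}. scale ((- q) powi (- int (n_inversions r \<sigma>)))
        (prod_list (map (\<lambda>j. minv A $$ (\<sigma> j, j)) (rev [0..<r]))))"
proof -
  have A: "A \<in> carrier_mat (r + s) (r + s)" and B: "minv A \<in> carrier_mat (r + s) (r + s)"
    using gen by (auto simp: generator_matrix_def super_manin_def)
  have mi: "minv (supertranspose s (flip_mat A)) = supertranspose s (flip_mat (minv A))"
    using gen by (intro minv_eqI supertranspose_flip_inverts[OF A B]
        supertranspose_flip_inverts[OF B A]) (auto simp: generator_matrix_def)
  have rev_upt: "rev [0..<k] = map (\<lambda>i. k - 1 - i) [0..<k]" for k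
    by (rule nth_equalityI) (auto simp: rev_nth)
  have lt: "\<sigma> i < k" if "\<sigma> permutes {..<k}" "i < k" for \<sigma> and i k :: nat
    using permutes_in_image[OF that(1), of i] that(2) by auto
  have ev: "prod_list (map (\<lambda>j. supertranspose s (flip_mat A) $$ (\<rho> j, j)) [0..<s])
      = prod_list (map (\<lambda>i. A $$ (r + i, r + (if i < s then s - 1 - \<rho> (s - 1 - i) else i)))
          (rev [0..<s]))" if p: "\<rho> permutes {..<s}" for \<rho>
    unfolding rev_upt map_map
    by (intro arg_cong[of _ _ prod_list] map_cong refl)
       (use A lt[OF p] in \<open>auto simp: supertranspose_def flip_mat_def parity_def
          intro!: arg_cong2[where f = "\<lambda>i j. A $$ (i,j)"]\<close>,
        (use lt[OF p] in \<open>fastforce\<close>)+)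
  have od: "prod_list (map (\<lambda>i. supertranspose s (flip_mat (minv A)) $$ (s + i, s + \<sigma> i)) [0..<r])
      = prod_list (map (\<lambda>j. minv A $$ ((if j < r then r - 1 - \<sigma> (r - 1 - j) else j), j))
          (rev [0..<r]))" if p: "\<sigma> permutes {..<r}" for \<sigma>
    unfolding rev_upt map_map
    by (intro arg_cong[of _ _ prod_list] map_cong refl)
       (use B lt[OF p] in \<open>auto simp: supertranspose_def flip_mat_def parity_def
          intro!: arg_cong2[where f = "\<lambda>i j. minv A $$ (i,j)"]\<close>)
  have "Ber scale q s r (supertranspose s (flip_mat A)) =
    (\<Sum>\<rho> | \<rho> permutes {..<s}. scale ((- q) powi (- int (n_inversions s \<rho>)))
        (prod_list (map (\<lambda>i. A $$ (r + i, r + (if i < s then s - 1 - \<rho> (s - 1 - i) else i)))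
          (rev [0..<s]))))
    * (\<Sum>\<sigma> | \<sigma> permutes {..<r}. scale ((- q) powi (- int (n_inversions r \<sigma>)))
        (prod_list (map (\<lambda>j. minv A $$ ((if j < r then r - 1 - \<sigma> (r - 1 - j) else j), j))
          (rev [0..<r]))))"
    unfolding Ber_def mi
    by (intro arg_cong2[where f = "(*)"] sum.cong refl arg_cong2[where f = scale] ev od) simp_all
  also have "\<dots> =
    (\<Sum>\<rho> | \<rho> permutes {..<s}. scale ((- q) powi (- int (n_inversions s \<rho>)))
        (prod_list (map (\<lambda>i. A $$ (r + i, r + \<rho> i)) (rev [0..<s]))))
    * (\<Sum>\<sigma> | \<sigma> permutes {..<r}. scale ((- q) powi (- int (n_inversions r \<sigma>)))
        (prod_list (map (\<lambda>j. minv A $$ (\<sigma> j, j)) (rev [0..<r]))))"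
    by (rule arg_cong2[where f = "(*)",
          OF sum_permutes_rev[symmetric, where F = "\<lambda>l \<rho>. scale ((- q) powi (- int l))
               (prod_list (map (\<lambda>i. A $$ (r + i, r + \<rho> i)) (rev [0..<s])))"]
             sum_permutes_rev[symmetric, where F = "\<lambda>l \<sigma>. scale ((- q) powi (- int l))
               (prod_list (map (\<lambda>j. minv A $$ (\<sigma> j, j)) (rev [0..<r])))"]])
  finally show ?thesis .
qed

end

theory Submission
  imports Defs "HOL-Combinatorics.Multiset_Permutations"
begin

text \<open>
  Put \<open>\<mu> = - q\<^sup>-\<^sup>1\<close>. The even part of the Berezinian is the coefficient of \<open>\<psi>\<^sub>0 \<dots> \<psi>\<^bsub>m-1\<^esub>\<close> in a
  product \<open>\<Psi>\<^sub>0 \<dots> \<Psi>\<^bsub>m-1\<^esub>\<close> of generic elements of a \<open>q\<close>-exterior algebra, and the Manin relations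
  say that the \<open>\<Psi>\<^sub>j\<close> again \<open>q\<close>-anticommute; the odd part is treated in the same way, with the rows
  of the odd block of \<open>M\<^sup>-\<^sup>1\<close> as the \<open>\<Psi>\<^sub>j\<close>. Modulo the other \<open>\<Psi>\<close>'s, those with index in one part
  of the index set can be replaced by the corresponding vectors of a Schur complement, which is a
  block of an inverse of a block of \<open>M\<close> or \<open>M\<^sup>-\<^sup>1\<close>. This factors the determinants and settles the
  case \<open>[m] \<subseteq> I\<close>. For \<open>I \<subseteq> [m]\<close> the resulting factors come in the wrong order, and it remains to see
  that the even determinant of a super Manin matrix commutes with the entries of the odd block
  of the inverse matrix; here the invertibility of the supertransposes is essential.
\<close>

section \<open>Exterior multiplication by generic elements\<close>

locale unital_algebra = vector_space scale
  for scale :: "'k::field \<Rightarrow> 'a::ring_1 \<Rightarrow> 'a" +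
  assumes mult_scale_left: "scale c x * y = scale c (x * y)"
    and mult_scale_right: "x * scale c y = scale c (x * y)"

sublocale superalgebra \<subseteq> unital_algebra
  by unfold_locales (simp_all add: scale_mult_left scale_mult_right)

text \<open>The monomial \<open>\<psi>\<^sub>J\<close> as a coefficient function;
  \<open>basis_form {}\<close> is the unit of the exterior algebra.\<close>

definition basis_form :: "nat set \<Rightarrow> nat set \<Rightarrow> 'a::ring_1"
  where "basis_form J K = (if K = J then 1 else 0)"

text \<open>Inversions of a word, counted letter by letter from the left because
  \<open>wedge\<close> splits off indices in that order.\<close>

fun list_inversions :: "nat list \<Rightarrow> nat" where
  "list_inversions [] = 0"
| "list_inversions (x # xs) = card {y \<in> set xs. y < x} + list_inversions xs"

context unital_algebra
begin

text \<open>
  A function \<open>F\<close> stands for \<open>\<Sum>\<^sub>K \<psi>\<^sub>K F(K)\<close>, where \<open>\<psi>\<^sub>K\<close> is the increasing product of the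
  \<open>\<psi>\<^sub>k\<close> with \<open>k \<in> K\<close>, and \<open>\<psi>\<^sub>i \<psi>\<^sub>k = \<mu> \<psi>\<^sub>k \<psi>\<^sub>i\<close> for \<open>k < i\<close>; monomials with a repeated factor are
  dropped. Then \<open>wedge \<mu> u\<close> is left multiplication by \<open>\<Sum>\<^sub>i \<psi>\<^sub>i u\<^sub>i\<close>.
\<close>

definition wedge :: "'k \<Rightarrow> (nat \<Rightarrow> 'a) \<Rightarrow> (nat set \<Rightarrow> 'a) \<Rightarrow> nat set \<Rightarrow> 'a"
  where "wedge \<mu> u F K = (\<Sum>i\<in>K. scale (\<mu> ^ card {k\<in>K. k < i}) (u i * F (K - {i})))"

fun wedges :: "'k \<Rightarrow> (nat \<Rightarrow> nat \<Rightarrow> 'a) \<Rightarrow> nat list \<Rightarrow> (nat set \<Rightarrow> 'a) \<Rightarrow> nat set \<Rightarrow> 'a" where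
  "wedges \<mu> Z [] F = F"
| "wedges \<mu> Z (j # js) F = wedge \<mu> (Z j) (wedges \<mu> Z js F)"

text \<open>For \<open>i < k\<close>, the coefficient of
  \<open>\<psi>\<^sub>i \<psi>\<^sub>k\<close> in the product of the elements with coefficients
  \<open>u\<close> and \<open>v\<close>.\<close>

definition pairing :: "'k \<Rightarrow> (nat \<Rightarrow> 'a) \<Rightarrow> (nat \<Rightarrow> 'a) \<Rightarrow> nat \<Rightarrow> nat \<Rightarrow> 'a"
  where "pairing \<mu> u v i k = u i * v k + scale \<mu> (u k * v i)"

text \<open>Coefficientwise form of \<open>\<Psi>\<^sub>j \<Psi>\<^sub>j = 0\<close> and
  \<open>\<Psi>\<^sub>l \<Psi>\<^sub>j = \<mu> \<Psi>\<^sub>j \<Psi>\<^sub>l\<close> for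
  \<open>j < l\<close>: the \<Psi>'s satisfy the relations of the \<psi>'s.\<close>

definition q_manin :: "'k \<Rightarrow> nat set \<Rightarrow> (nat \<Rightarrow> nat \<Rightarrow> 'a) \<Rightarrow> bool"
  where "q_manin \<mu> C Z \<longleftrightarrow>
    (\<forall>j\<in>C. \<forall>i k. i < k \<longrightarrow> pairing \<mu> (Z j) (Z j) i k = 0) \<and>
    (\<forall>j\<in>C. \<forall>l\<in>C. j < l \<longrightarrow>
      (\<forall>i k. i < k \<longrightarrow> pairing \<mu> (Z l) (Z j) i k = scale \<mu> (pairing \<mu> (Z j) (Z l) i k)))"

section \<open>Linearity of exterior multiplication\<close>

lemma wedges_append: "wedges \<mu> Z (xs @ ys) F = wedges \<mu> Z xs (wedges \<mu> Z ys F)"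
  by (induction xs) auto

lemma wedge_infinite: "infinite K \<Longrightarrow> wedge \<mu> u F K = 0"
  by (simp add: wedge_def)

lemma wedge_scale: "wedge \<mu> u (\<lambda>K. scale c (F K)) = (\<lambda>K. scale c (wedge \<mu> u F K))"
  by (rule ext) (simp add: wedge_def mult_scale_right scale_sum_right mult.commute)

lemma wedge_mult_right: "wedge \<mu> u (\<lambda>K. F K * h) = (\<lambda>K. wedge \<mu> u F K * h)"
  by (rule ext) (simp add: wedge_def sum_distrib_right mult_scale_left mult.assoc)

lemma wedges_mult_right: "wedges \<mu> Z ws (\<lambda>K. F K * h) = (\<lambda>K. wedges \<mu> Z ws F K * h)"
  by (induction ws) (simp_all add: wedge_mult_right)

lemma wedge_sum: "wedge \<mu> u (\<lambda>K. \<Sum>x\<in>X. F x K) = (\<lambda>K. \<Sum>x\<in>X. wedge \<mu> u (F x) K)"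
  by (rule ext) (simp add: wedge_def sum_distrib_left scale_sum_right sum.swap[of _ X])

lemma wedges_sum: "wedges \<mu> Z ws (\<lambda>K. \<Sum>x\<in>X. F x K) = (\<lambda>K. \<Sum>x\<in>X. wedges \<mu> Z ws (F x) K)"
  by (induction ws) (simp_all add: wedge_sum)

lemma wedge_add: "wedge \<mu> u (\<lambda>K. F K + H K) = (\<lambda>K. wedge \<mu> u F K + wedge \<mu> u H K)"
  by (rule ext) (simp add: wedge_def distrib_left scale_right_distrib sum.distrib)

lemma wedges_add: "wedges \<mu> Z ws (\<lambda>K. F K + H K) = (\<lambda>K. wedges \<mu> Z ws F K + wedges \<mu> Z ws H K)"
  by (induction ws) (simp_all add: wedge_add)

lemma wedge_zero: "wedge \<mu> u (\<lambda>K. 0) = (\<lambda>K. 0)"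
  by (rule ext) (simp add: wedge_def)

lemma wedge_column_add: "wedge \<mu> (\<lambda>i. u i + v i) F = (\<lambda>K. wedge \<mu> u F K + wedge \<mu> v F K)"
  by (rule ext) (simp add: wedge_def distrib_right scale_right_distrib sum.distrib)

lemma wedge_column_sum: "wedge \<mu> (\<lambda>i. \<Sum>x\<in>X. u x i) F = (\<lambda>K. \<Sum>x\<in>X. wedge \<mu> (u x) F K)"
  by (rule ext) (simp add: wedge_def sum_distrib_right scale_sum_right sum.swap[of _ X])

lemma wedge_column_mult_left: "wedge \<mu> (\<lambda>i. c * u i) F = (\<lambda>K. c * wedge \<mu> u F K)"
  by (rule ext) (simp add: wedge_def sum_distrib_left mult_scale_right mult.assoc)

lemma wedge_column_mult_right: "wedge \<mu> (\<lambda>i. u i * c) F = wedge \<mu> u (\<lambda>K. c * F K)"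
  by (rule ext) (simp add: wedge_def mult.assoc)

text \<open>The two orders of removing \<open>i < k\<close> from \<open>K\<close> differ by one
  factor \<mu>, since \<open>i\<close> counts below \<open>k\<close> only while it is still present;
  \<open>pairing\<close> collects both terms.\<close>

lemma wedge_wedge:
  assumes "finite K"
  shows "wedge \<mu> u (wedge \<mu> v F) K =
    (\<Sum>(i,k)\<in>{(i,k). i \<in> K \<and> k \<in> K \<and> i < k}.
      scale (\<mu> ^ (card {x\<in>K. x < i} + card {x\<in>K - {i}. x < k}))
        (pairing \<mu> u v i k * F (K - {i,k})))"
proof -
  define n where "n = (\<lambda>K i. card {x\<in>K. x < (i::nat)})"
  define f where "f = (\<lambda>(i,k). scale (\<mu> ^ (n K i + n (K - {i}) k)) (u i * v k * F (K - {i,k})))"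
  define P where "P = {(i,k). i \<in> K \<and> k \<in> K \<and> i < k}"
  define P' where "P' = {(i,k). i \<in> K \<and> k \<in> K \<and> k < i}"
  have fin: "finite P" "finite P'"
    by (rule finite_subset[of _ "K \<times> K"]; auto simp: P_def P'_def assms)+
  have un: "Sigma K (\<lambda>i. K - {i}) = P \<union> P'"
    by (auto simp: P_def P'_def)
  have n1: "n (K - {k}) i = n K i" if "i < k" for i k
    unfolding n_def by (rule arg_cong[of _ _ card]) (use that in auto)
  have n2: "n K k = Suc (n (K - {i}) k)" if "i < k" "i \<in> K" for i k
  proof -
    have "{x\<in>K. x < k} = insert i {x\<in>K - {i}. x < k}" using that by auto
    then show ?thesis using assms by (simp add: n_def)
  qed
  have "wedge \<mu> u (wedge \<mu> v F) K = (\<Sum>i\<in>K. \<Sum>k\<in>K - {i}. f (i,k))"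
    unfolding wedge_def f_def n_def
    by (simp add: sum_distrib_left scale_sum_right mult_scale_right power_add mult.assoc
        insert_commute Diff_insert2[symmetric])
  also have "\<dots> = sum f (P \<union> P')"
    using assms by (subst sum.Sigma) (auto simp: un)
  also have "\<dots> = sum f P + sum f P'"
    by (rule sum.union_disjoint[OF fin]) (auto simp: P_def P'_def)
  also have "sum f P' = (\<Sum>(i,k)\<in>P. f (k,i))"
    by (rule sum.reindex_bij_witness[of _ "\<lambda>(i,k). (k,i)" "\<lambda>(i,k). (k,i)"])
       (auto simp: P_def P'_def)
  also have "sum f P + \<dots> = (\<Sum>(i,k)\<in>P. f (i,k) + f (k,i))"
    by (simp add: sum.distrib split_def)
  also have "\<dots> = (\<Sum>(i,k)\<in>P. scale (\<mu> ^ (n K i + n (K - {i}) k)) (pairing \<mu> u v i k * F (K - {i,k})))"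
  proof (intro sum.cong refl, clarify)
    fix i k assume "(i,k) \<in> P"
    then have ik: "i \<in> K" "k \<in> K" "i < k" by (auto simp: P_def)
    have "n K k + n (K - {k}) i = Suc (n K i + n (K - {i}) k)"
      using n1[OF ik(3)] n2[OF ik(3,1)] by simp
    then have "f (k,i) = scale (\<mu> ^ Suc (n K i + n (K - {i}) k)) (u k * v i * F (K - {i,k}))"
      by (simp add: f_def insert_commute del: power_Suc)
    then show "f (i,k) + f (k,i) = scale (\<mu> ^ (n K i + n (K - {i}) k)) (pairing \<mu> u v i k * F (K - {i,k}))"
      by (simp add: f_def pairing_def distrib_right scale_right_distrib mult_scale_left mult.commute)
  qed
  finally show ?thesis by (simp add: P_def n_def)
qed

lemma wedge_null:
  assumes "\<And>i k. i < k \<Longrightarrow> pairing \<mu> u u i k = 0"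
  shows "wedge \<mu> u (wedge \<mu> u F) = (\<lambda>K. 0)"
proof
  fix K :: "nat set"
  show "wedge \<mu> u (wedge \<mu> u F) K = 0"
    by (cases "finite K") (auto simp: wedge_infinite wedge_wedge assms intro!: sum.neutral)
qed

text \<open>The vector \<open>u'\<close> is kept separate from \<open>u\<close> so that the exchange
  also covers a vector that changes a sign while it is passed.\<close>

lemma wedge_swap:
  assumes "\<And>i k. i < k \<Longrightarrow> pairing \<mu> v u' i k = scale c (pairing \<mu> u v i k)"
  shows "wedge \<mu> v (wedge \<mu> u' F) = (\<lambda>K. scale c (wedge \<mu> u (wedge \<mu> v F) K))"
proof
  fix K :: "nat set"
  show "wedge \<mu> v (wedge \<mu> u' F) K = scale c (wedge \<mu> u (wedge \<mu> v F) K)"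
  proof (cases "finite K")
    case True
    show ?thesis
      unfolding wedge_wedge[OF True] scale_sum_right
      by (intro sum.cong refl) (auto simp: assms mult_scale_left mult.commute)
  qed (simp add: wedge_infinite)
qed

section \<open>Reordering products and cancelling repeated factors\<close>

lemma q_manin_wedge_null: "q_manin \<mu> C Z \<Longrightarrow> j \<in> C \<Longrightarrow> wedge \<mu> (Z j) (wedge \<mu> (Z j) F) = (\<lambda>K. 0)"
  by (rule wedge_null) (auto simp: q_manin_def)

lemma q_manin_wedge_swap:
  "q_manin \<mu> C Z \<Longrightarrow> j \<in> C \<Longrightarrow> l \<in> C \<Longrightarrow> j < l \<Longrightarrow>
    wedge \<mu> (Z l) (wedge \<mu> (Z j) F) = (\<lambda>K. scale \<mu> (wedge \<mu> (Z j) (wedge \<mu> (Z l) F) K))"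
  by (rule wedge_swap) (auto simp: q_manin_def)

text \<open>Every smaller entry that \<open>x\<close> passes on the way to its place contributes one
  factor \<mu>.\<close>

lemma wedge_wedges_insort:
  assumes "q_manin \<mu> C Z" "set (x # xs) \<subseteq> C" "sorted xs" "distinct (x # xs)"
  shows "wedges \<mu> Z (x # xs) F =
    (\<lambda>K. scale (\<mu> ^ card {y\<in>set xs. y < x}) (wedges \<mu> Z (insort x xs) F K))"
  using assms(2-)
proof (induction xs)
  case (Cons y ys)
  show ?case
  proof (cases "x \<le> y")
    case True
    then have "{z\<in>set (y # ys). z < x} = {}" using Cons.prems by auto
    then show ?thesis unfolding \<open>{z\<in>set (y # ys). z < x} = {}\<close> using True by simp
  next
    case False
    then have yx: "y < x" by simp
    then have "{z\<in>set (y # ys). z < x} = insert y {z\<in>set ys. z < x}" by auto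
    then have card: "card {z\<in>set (y # ys). z < x} = Suc (card {z\<in>set ys. z < x})"
      using Cons.prems by simp
    have "wedges \<mu> Z (x # y # ys) F = (\<lambda>K. scale \<mu> (wedge \<mu> (Z y) (wedges \<mu> Z (x # ys) F) K))"
      using q_manin_wedge_swap[OF assms(1) _ _ yx] Cons.prems by auto
    also have "wedges \<mu> Z (x # ys) F =
        (\<lambda>K. scale (\<mu> ^ card {y\<in>set ys. y < x}) (wedges \<mu> Z (insort x ys) F K))"
      using Cons by auto
    finally show ?thesis
      using False by (simp only: card wedge_scale) simp
  qed
qed simp

lemma wedges_sort:
  assumes "q_manin \<mu> C Z" "set xs \<subseteq> C" "distinct xs"
  shows "wedges \<mu> Z xs F = (\<lambda>K. scale (\<mu> ^ list_inversions xs) (wedges \<mu> Z (sort xs) F K))"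
  using assms(2-)
proof (induction xs)
  case (Cons x xs)
  have "wedges \<mu> Z (x # xs) F = (\<lambda>K. scale (\<mu> ^ list_inversions xs) (wedges \<mu> Z (x # sort xs) F K))"
    using Cons by (simp add: wedge_scale)
  also have "wedges \<mu> Z (x # sort xs) F =
      (\<lambda>K. scale (\<mu> ^ card {y\<in>set xs. y < x}) (wedges \<mu> Z (sort (x # xs)) F K))"
    using wedge_wedges_insort[OF assms(1), of x "sort xs"] Cons.prems by simp
  finally show ?case by (simp add: power_add mult.commute)
qed simp

text \<open>The factor \<open>x\<close> is moved rightwards until it meets its other occurrence,
  where the square vanishes. Passing a larger factor in this direction means cancelling \<mu>, hence
  \<open>\<mu> \<noteq> 0\<close>.\<close>

lemma wedges_repeated:
  assumes "q_manin \<mu> C Z" "\<mu> \<noteq> 0" "set (x # xs) \<subseteq> C" "x \<in> set xs"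
  shows "wedges \<mu> Z (x # xs) F = (\<lambda>K. 0)"
  using assms(3-)
proof (induction xs)
  case (Cons y ys)
  show ?case
  proof (cases "x = y")
    case True
    then show ?thesis using q_manin_wedge_null[OF assms(1), of x] Cons.prems by simp
  next
    case False
    have "wedge \<mu> (Z x) (wedges \<mu> Z ys F) = (\<lambda>K. 0)" using Cons False by simp
    then have y: "wedge \<mu> (Z y) (wedge \<mu> (Z x) (wedges \<mu> Z ys F)) = (\<lambda>K. 0)"
      by (simp add: wedge_zero)
    consider "y < x" | "x < y" using False by linarith
    then show ?thesis
    proof cases
      case 1
      then show ?thesis using q_manin_wedge_swap[OF assms(1), of y x] Cons.prems y by simp
    next
      case 2
      have xy: "wedge \<mu> (Z y) (wedge \<mu> (Z x) (wedges \<mu> Z ys F)) =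
          (\<lambda>K. scale \<mu> (wedge \<mu> (Z x) (wedge \<mu> (Z y) (wedges \<mu> Z ys F)) K))"
        using q_manin_wedge_swap[OF assms(1), of x y] Cons.prems 2 by simp
      show ?thesis
        using fun_cong[OF xy] y assms(2) by (intro ext) (simp add: scale_eq_0_iff)
    qed
  qed
qed simp

end

section \<open>Inversions and quantum determinants\<close>

text \<open>For disjoint sets, the exponent of \<mu> when
  \<open>\<psi>\<^sub>A \<psi>\<^sub>J\<close> is sorted.\<close>

definition cross_inversions :: "nat set \<Rightarrow> nat set \<Rightarrow> nat"
  where "cross_inversions A J = card {(a,j). a \<in> A \<and> j \<in> J \<and> j < a}"

lemma cross_inversions_remove:
  assumes "finite A" "finite J" "i \<in> A"
  shows "cross_inversions A J = card {j\<in>J. j < i} + cross_inversions (A - {i}) J"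
proof -
  have eq: "{(a,j). a \<in> A \<and> j \<in> J \<and> j < a} =
      Pair i ` {j\<in>J. j < i} \<union> {(a,j). a \<in> A - {i} \<and> j \<in> J \<and> j < a}"
    using assms(3) by auto
  have "finite {(a,j). a \<in> A - {i} \<and> j \<in> J \<and> j < a}"
    by (rule finite_subset[of _ "A \<times> J"]) (use assms in auto)
  then show ?thesis
    unfolding cross_inversions_def eq using assms(2)
    by (subst card_Un_disjoint) (auto simp: card_image inj_on_def)
qed

lemma cross_inversions_empty [simp]: "cross_inversions {} J = 0"
  by (simp add: cross_inversions_def)

lemma cross_inversions_eq_0: "(\<And>a j. a \<in> A \<Longrightarrow> j \<in> J \<Longrightarrow> a < j) \<Longrightarrow> cross_inversions A J = 0"
  by (force simp: cross_inversions_def card_eq_0_iff)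

lemma list_inversions_append:
  assumes "distinct (xs @ ys)"
  shows "list_inversions (xs @ ys) =
    list_inversions xs + list_inversions ys + cross_inversions (set xs) (set ys)"
  using assms
proof (induction xs)
  case (Cons x xs)
  have "{y \<in> set (xs @ ys). y < x} = {y \<in> set xs. y < x} \<union> {y \<in> set ys. y < x}" by auto
  then have "card {y \<in> set (xs @ ys). y < x} = card {y \<in> set xs. y < x} + card {y \<in> set ys. y < x}"
    using Cons.prems by (simp only:) (rule card_Un_disjoint, auto)
  moreover have "cross_inversions (set (x # xs)) (set ys) =
      card {y \<in> set ys. y < x} + cross_inversions (set xs) (set ys)"
    using cross_inversions_remove[of "set (x # xs)" "set ys" x] Cons.prems by simp
  ultimately show ?case using Cons by simp
qed simp

lemma list_inversions_sorted: "sorted xs \<Longrightarrow> list_inversions xs = 0"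
proof (induction xs)
  case (Cons x xs)
  then have "{y \<in> set xs. y < x} = {}" by auto
  with Cons show ?case by simp
qed simp

lemma list_inversions_snoc:
  assumes "distinct (xs @ [y])"
  shows "list_inversions (xs @ [y]) = list_inversions xs + card {x \<in> set xs. y < x}"
proof -
  have "{(a,j). a \<in> set xs \<and> j \<in> set [y] \<and> j < a} = (\<lambda>x. (x,y)) ` {x \<in> set xs. y < x}" by auto
  then have "cross_inversions (set xs) (set [y]) = card {x \<in> set xs. y < x}"
    by (simp add: cross_inversions_def card_image inj_on_def)
  then show ?thesis using list_inversions_append[OF assms] by simp
qed

text \<open>Each pair of positions is an inversion in exactly one of the two words, so the sum
  counts all pairs.\<close>

lemma list_inversions_rev:
  assumes "distinct xs"
  shows "list_inversions (rev xs) + list_inversions xs = (\<Sum>i<length xs. i)"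
  using assms
proof (induction xs)
  case (Cons x xs)
  have eq: "set xs = {y \<in> set xs. x < y} \<union> {y \<in> set xs. y < x}"
    using Cons.prems by (auto simp: not_less order_le_less)
  have "card (set xs) = card {y \<in> set xs. x < y} + card {y \<in> set xs. y < x}"
    by (subst eq, rule card_Un_disjoint) auto
  then show ?case
    using Cons list_inversions_snoc[of "rev xs" x] by (simp add: distinct_card)
qed simp

text \<open>By induction on \<open>r\<close>: the last position adds the earlier values that exceed
  \<open>\<sigma> r\<close>, which is also what appending a letter to a word adds.\<close>

lemma n_inversions_eq_list_inversions:
  assumes "inj_on \<sigma> {..<r}"
  shows "n_inversions r \<sigma> = list_inversions (map \<sigma> [0..<r])"
  using assms
proof (induction r)
  case 0
  then show ?case by (simp add: n_inversions_def)
next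
  case (Suc r)
  have eq: "{(i,j). i < j \<and> j < Suc r \<and> \<sigma> j < \<sigma> i} =
      {(i,j). i < j \<and> j < r \<and> \<sigma> j < \<sigma> i} \<union> (\<lambda>i. (i,r)) ` {i. i < r \<and> \<sigma> r < \<sigma> i}"
    by (auto simp: less_Suc_eq)
  have fin: "finite {(i,j). i < j \<and> j < r \<and> \<sigma> j < \<sigma> i}"
    by (rule finite_subset[of _ "{..<r} \<times> {..<r}"]) auto
  have "{x \<in> set (map \<sigma> [0..<r]). \<sigma> r < x} = \<sigma> ` {i. i < r \<and> \<sigma> r < \<sigma> i}" by auto
  moreover have "inj_on \<sigma> {i. i < r \<and> \<sigma> r < \<sigma> i}"
    by (rule inj_on_subset[OF Suc.prems]) auto
  ultimately have "card {x \<in> set (map \<sigma> [0..<r]). \<sigma> r < x} = card {i. i < r \<and> \<sigma> r < \<sigma> i}"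
    by (simp add: card_image)
  moreover have "distinct (map \<sigma> [0..<r] @ [\<sigma> r])"
    using Suc.prems inj_onD[OF Suc.prems, of r] inj_on_subset[OF Suc.prems, of "{..<r}"]
    by (force simp: distinct_map atLeast0LessThan)
  moreover have "n_inversions (Suc r) \<sigma> = n_inversions r \<sigma> + card {i. i < r \<and> \<sigma> r < \<sigma> i}"
    unfolding n_inversions_def eq using fin
    by (subst card_Un_disjoint) (auto simp: card_image inj_on_def)
  moreover have "n_inversions r \<sigma> = list_inversions (map \<sigma> [0..<r])"
    by (rule Suc.IH, rule inj_on_subset[OF Suc.prems]) auto
  ultimately show ?case using list_inversions_snoc[of "map \<sigma> [0..<r]" "\<sigma> r"] by simp
qed

lemma sum_permutations_of_set_lessThan:
  fixes F :: "nat list \<Rightarrow> 'b::comm_monoid_add"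
  shows "(\<Sum>xs\<in>permutations_of_set {..<r}. F xs) = (\<Sum>\<sigma> | \<sigma> permutes {..<r}. F (map \<sigma> [0..<r]))"
proof (rule sum.reindex_bij_witness[where j = "\<lambda>xs i. if i < r then xs ! i else i"
      and i = "\<lambda>\<sigma>. map \<sigma> [0..<r]"])
  fix xs assume xs: "xs \<in> permutations_of_set {..<r}"
  then have len: "length xs = r"
    using length_finite_permutations_of_set[OF xs] by simp
  have st: "set xs = {..<r}" and d: "distinct xs"
    using xs by (auto simp: permutations_of_set_def)
  show eq: "map (\<lambda>i. if i < r then xs ! i else i) [0..<r] = xs"
    by (rule nth_equalityI) (auto simp: len)
  show "F (map (\<lambda>i. if i < r then xs ! i else i) [0..<r]) = F xs"
    by (simp only: eq)
  have "bij_betw (\<lambda>i. xs ! i) {..<r} {..<r}"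
    by (rule bij_betw_nth[OF d]) (simp_all add: len st)
  then have "bij_betw (\<lambda>i. if i < r then xs ! i else i) {..<r} {..<r}"
    by (subst bij_betw_cong[where g = "\<lambda>i. xs ! i"]) simp_all
  then show "(\<lambda>i. if i < r then xs ! i else i) \<in> {\<sigma>. \<sigma> permutes {..<r}}"
    by (auto intro!: bij_imp_permutes split: if_splits)
next
  fix \<sigma> assume "\<sigma> \<in> {\<sigma>. \<sigma> permutes {..<r}}"
  then have p: "\<sigma> permutes {..<r}" by simp
  show "(\<lambda>i. if i < r then map \<sigma> [0..<r] ! i else i) = \<sigma>"
    by (rule ext) (simp add: permutes_not_in[OF p])
  show "map \<sigma> [0..<r] \<in> permutations_of_set {..<r}"
    by (simp add: permutations_of_set_def distinct_map atLeast0LessThan permutes_image[OF p]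
        permutes_inj_on[OF p])
qed

lemma sum_permutations_of_set_rev:
  "(\<Sum>xs\<in>permutations_of_set A. F xs) = (\<Sum>xs\<in>permutations_of_set A. F (rev xs))"
  by (rule sum.reindex_bij_witness[where i = rev and j = rev]) (auto simp: permutations_of_set_def)

context unital_algebra
begin

definition qdet :: "'k \<Rightarrow> nat \<Rightarrow> (nat \<Rightarrow> nat \<Rightarrow> 'a) \<Rightarrow> 'a"
  where "qdet \<mu> r Z = (\<Sum>\<sigma> | \<sigma> permutes {..<r}. scale (\<mu> ^ n_inversions r \<sigma>)
    (prod_list (map (\<lambda>j. Z j (\<sigma> j)) [0..<r])))"

text \<open>Each \<open>wedge\<close> chooses the next letter of a word and charges it for the
  smaller indices still in \<open>K\<close>; these charges add up to
  \<open>list_inversions\<close>.\<close>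

lemma wedges_eq_sum_permutations:
  assumes "finite K" "length ws = card K"
  shows "wedges \<mu> Z ws (basis_form {}) K =
    (\<Sum>xs\<in>permutations_of_set K. scale (\<mu> ^ list_inversions xs) (prod_list (map2 Z ws xs)))"
  using assms
proof (induction ws arbitrary: K)
  case Nil
  then show ?case by (simp add: basis_form_def)
next
  case (Cons w ws)
  have K: "K \<noteq> {}" using Cons.prems(2) by auto
  have [simp]: "finite (permutations_of_set (K - {x}))" for x
    using Cons.prems by simp
  have len: "length ws = card (K - {x})" if "x \<in> K" for x
    using Cons.prems that by simp
  have st: "{y\<in>set xs. y < x} = {k\<in>K. k < x}" if "xs \<in> permutations_of_set (K - {x})" for x xs
    using that by (auto simp: permutations_of_set_def)
  have "(\<Sum>xs\<in>permutations_of_set K. scale (\<mu> ^ list_inversions xs) (prod_list (map2 Z (w # ws) xs)))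
    = (\<Sum>x\<in>K. \<Sum>xs\<in>permutations_of_set (K - {x}).
        scale (\<mu> ^ list_inversions (x # xs)) (prod_list (map2 Z (w # ws) (x # xs))))"
    unfolding permutations_of_set_nonempty[OF K]
    using Cons.prems(1)
    by (subst sum.UNION_disjoint) (simp_all add: sum.reindex inj_on_def, blast)
  also have "\<dots> = (\<Sum>x\<in>K. scale (\<mu> ^ card {k\<in>K. k < x}) (Z w x *
      (\<Sum>xs\<in>permutations_of_set (K - {x}). scale (\<mu> ^ list_inversions xs) (prod_list (map2 Z ws xs)))))"
    by (intro sum.cong refl)
       (simp add: sum_distrib_left scale_sum_right mult_scale_right power_add st cong: sum.cong)
  also have "\<dots> = wedges \<mu> Z (w # ws) (basis_form {}) K"
    unfolding wedges.simps wedge_def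
    by (intro sum.cong refl) (simp add: Cons.IH[OF _ len] Cons.prems(1))
  finally show ?case by simp
qed

lemma qdet_eq_wedges: "qdet \<mu> r Z = wedges \<mu> Z [0..<r] (basis_form {}) {..<r}"
  unfolding wedges_eq_sum_permutations[of "{..<r}" "[0..<r]", simplified]
    sum_permutations_of_set_lessThan qdet_def
  by (intro sum.cong refl)
     (simp add: n_inversions_eq_list_inversions permutes_inj_on zip_map2 zip_same_conv_map o_def)

text \<open>Sorting the reversed product costs \<open>\<mu> ^ N\<close>, where \<open>N\<close> is
  the number of pairs, while reversing a word turns \<open>l\<close> inversions into
  \<open>N - l\<close>. Cancelling \<open>\<mu> ^ N\<close> leaves the weights in
  \<open>inverse \<mu>\<close>.\<close>

lemma qdet_reversed:
  assumes Z: "q_manin \<mu> {..<r} Z" and \<mu>: "\<mu> \<noteq> 0"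
  shows "(\<Sum>\<sigma> | \<sigma> permutes {..<r}. scale (inverse \<mu> ^ n_inversions r \<sigma>)
    (prod_list (map (\<lambda>j. Z j (\<sigma> j)) (rev [0..<r])))) = qdet \<mu> r Z"
    (is "?L = _")
proof -
  define N where "N = (\<Sum>i<r. i)"
  have "list_inversions (rev [0..<r]) = N"
    using list_inversions_rev[of "[0..<r]"] by (simp add: N_def list_inversions_sorted)
  moreover have "sort (rev [0..<r]) = [0..<r]"
    by (metis distinct_upt set_rev set_upt sorted_list_of_set_sort_remdups
        sorted_list_of_set_range distinct_rev distinct_remdups_id)
  ultimately have "scale (\<mu> ^ N) (qdet \<mu> r Z) = wedges \<mu> Z (rev [0..<r]) (basis_form {}) {..<r}"
    unfolding qdet_eq_wedges using wedges_sort[OF Z, of "rev [0..<r]" "basis_form {}"]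
    by (simp add: atLeast0LessThan)
  also have "\<dots> = (\<Sum>xs\<in>permutations_of_set {..<r}. scale (\<mu> ^ list_inversions (rev xs))
      (prod_list (map2 Z (rev [0..<r]) (rev xs))))"
    by (subst wedges_eq_sum_permutations) (simp_all, rule sum_permutations_of_set_rev)
  also have "\<dots> = (\<Sum>\<sigma> | \<sigma> permutes {..<r}. scale (\<mu> ^ list_inversions (rev (map \<sigma> [0..<r])))
      (prod_list (map2 Z (rev [0..<r]) (rev (map \<sigma> [0..<r])))))"
    by (rule sum_permutations_of_set_lessThan)
  also have "\<dots> = (\<Sum>\<sigma> | \<sigma> permutes {..<r}. scale (\<mu> ^ N * inverse \<mu> ^ n_inversions r \<sigma>)
      (prod_list (map (\<lambda>j. Z j (\<sigma> j)) (rev [0..<r]))))"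
  proof (intro sum.cong refl arg_cong2[where f = scale])
    fix \<sigma> assume "\<sigma> \<in> {\<sigma>. \<sigma> permutes {..<r}}"
    then have i: "inj_on \<sigma> {..<r}" by (simp add: permutes_inj_on)
    then have "distinct (map \<sigma> [0..<r])" by (simp add: distinct_map atLeast0LessThan)
    from list_inversions_rev[OF this]
    have "N = list_inversions (rev (map \<sigma> [0..<r])) + n_inversions r \<sigma>"
      by (simp add: N_def n_inversions_eq_list_inversions[OF i])
    then show "\<mu> ^ list_inversions (rev (map \<sigma> [0..<r])) = \<mu> ^ N * inverse \<mu> ^ n_inversions r \<sigma>"
      using \<mu> by (simp add: power_add power_inverse)
    have "map2 Z (rev [0..<r]) (rev (map \<sigma> [0..<r])) = map (\<lambda>j. Z j (\<sigma> j)) (rev [0..<r])"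
      by (simp add: rev_map[symmetric] zip_map2 zip_same_conv_map) (simp add: rev_map zip_map2 zip_same_conv_map)
    then show "prod_list (map2 Z (rev [0..<r]) (rev (map \<sigma> [0..<r]))) =
        prod_list (map (\<lambda>j. Z j (\<sigma> j)) (rev [0..<r]))" by simp
  qed
  also have "\<dots> = scale (\<mu> ^ N) ?L" by (simp add: scale_sum_right)
  finally show ?thesis using \<mu> by simp
qed

section \<open>Relabelling and restricting index sets\<close>

lemma wedges_relabel:
  assumes "finite K" "K \<subseteq> A" "strict_mono_on A p"
    and "\<And>j i. j \<in> set ws \<Longrightarrow> i \<in> K \<Longrightarrow> Z' j i = Z (p j) (p i)"
  shows "wedges \<mu> Z' ws (basis_form {}) K = wedges \<mu> Z (map p ws) (basis_form {}) (p ` K)"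
  using assms
proof (induction ws arbitrary: K)
  case Nil
  then show ?case by (simp add: basis_form_def)
next
  case (Cons w ws)
  have inj: "inj_on p A" using assms(3) by (rule strict_mono_on_imp_inj_on)
  have injK: "inj_on p K" by (rule inj_on_subset[OF inj Cons.prems(2)])
  have card: "card {k\<in>p ` K. k < p i} = card {k\<in>K. k < i}" if "i \<in> K" for i
  proof -
    have "{k\<in>p ` K. k < p i} = p ` {k\<in>K. k < i}"
      using that Cons.prems(2) by (auto simp: strict_mono_on_less[OF assms(3)] subset_iff intro!: imageI)
    moreover have "inj_on p {k\<in>K. k < i}" by (rule inj_on_subset[OF injK]) auto
    ultimately show ?thesis by (simp add: card_image)
  qed
  have diff: "p ` K - {p i} = p ` (K - {i})" if "i \<in> K" for i
    using inj_on_image_set_diff[OF injK, of K "{i}"] that by auto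
  have "wedges \<mu> Z' ws (basis_form {}) (K - {i}) = wedges \<mu> Z (map p ws) (basis_form {}) (p ` (K - {i}))"
    for i by (rule Cons.IH) (use Cons.prems in auto)
  then show ?case
    unfolding wedges.simps list.map wedge_def
    by (subst sum.reindex[OF injK]) (auto simp: card diff Cons.prems intro!: sum.cong)
qed

lemma wedges_basis_form:
  assumes "finite B"
  shows "wedges \<mu> Z ws (basis_form J) B =
    (if J \<subseteq> B then scale (\<mu> ^ cross_inversions (B - J) J) (wedges \<mu> Z ws (basis_form {}) (B - J)) else 0)"
  using assms
proof (induction ws arbitrary: B)
  case Nil
  then show ?case by (auto simp: basis_form_def)
next
  case (Cons w ws)
  show ?case
  proof (cases "J \<subseteq> B")
    case False
    then have "\<not> J \<subseteq> B - {i}" for i by auto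
    then show ?thesis using False Cons by (simp add: wedge_def)
  next
    case True
    then have J: "finite J" using Cons.prems finite_subset by blast
    have n: "card {k\<in>B. k < i} + cross_inversions (B - {i} - J) J =
        cross_inversions (B - J) J + card {k\<in>B - J. k < i}" if "i \<in> B - J" for i
    proof -
      have "{k\<in>B. k < i} = {k\<in>B - J. k < i} \<union> {k\<in>J. k < i}" using True by auto
      then have "card {k\<in>B. k < i} = card {k\<in>B - J. k < i} + card {k\<in>J. k < i}"
        using Cons.prems J by (simp only:) (rule card_Un_disjoint, auto)
      moreover have "B - J - {i} = B - {i} - J" by auto
      ultimately show ?thesis
        using cross_inversions_remove[of "B - J" J i] Cons.prems J that by simp
    qed
    have "wedges \<mu> Z (w # ws) (basis_form J) B = (\<Sum>i\<in>B. if i \<in> B - J then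
        scale (\<mu> ^ card {k\<in>B. k < i}) (Z w i * scale (\<mu> ^ cross_inversions (B - {i} - J) J)
          (wedges \<mu> Z ws (basis_form {}) (B - {i} - J))) else 0)"
      unfolding wedges.simps wedge_def
      by (intro sum.cong refl) (use Cons True in auto)
    also have "\<dots> = (\<Sum>i\<in>B - J. scale (\<mu> ^ card {k\<in>B. k < i}) (Z w i *
        scale (\<mu> ^ cross_inversions (B - {i} - J) J) (wedges \<mu> Z ws (basis_form {}) (B - {i} - J))))"
      using Cons.prems by (intro sum.mono_neutral_cong_right) auto
    also have "\<dots> = (\<Sum>i\<in>B - J. scale (\<mu> ^ cross_inversions (B - J) J) (scale (\<mu> ^ card {k\<in>B - J. k < i})
        (Z w i * wedges \<mu> Z ws (basis_form {}) (B - J - {i}))))"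
    proof (intro sum.cong refl)
      fix i assume i: "i \<in> B - J"
      have "B - J - {i} = B - {i} - J" by auto
      then show "scale (\<mu> ^ card {k\<in>B. k < i}) (Z w i *
        scale (\<mu> ^ cross_inversions (B - {i} - J) J) (wedges \<mu> Z ws (basis_form {}) (B - {i} - J))) =
        scale (\<mu> ^ cross_inversions (B - J) J) (scale (\<mu> ^ card {k\<in>B - J. k < i})
        (Z w i * wedges \<mu> Z ws (basis_form {}) (B - J - {i})))"
        using n[OF i] by (simp add: mult_scale_right flip: power_add)
    qed
    finally show ?thesis using True by (simp add: wedge_def scale_sum_right)
  qed
qed

text \<open>Vectors without components in \<open>J\<close> can only remove indices of
  \<open>B - J\<close>; as there are exactly as many of them, they remove all of these and reach
  \<open>F\<close> at \<open>J\<close> only.\<close>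

lemma wedges_supported:
  assumes "finite B" "J \<subseteq> B" "card (B - J) = length ws"
    and "\<And>j i. j \<in> set ws \<Longrightarrow> i \<in> J \<Longrightarrow> T j i = 0"
  shows "wedges \<mu> T ws F B = wedges \<mu> T ws (basis_form J) B * F J"
  using assms
proof (induction ws arbitrary: B)
  case Nil
  then have "B = J" by auto
  then show ?case by (simp add: basis_form_def)
next
  case (Cons w ws)
  have "T w i * wedges \<mu> T ws F (B - {i}) = T w i * wedges \<mu> T ws (basis_form J) (B - {i}) * F J"
    if "i \<in> B" for i
  proof (cases "i \<in> J")
    case False
    have "wedges \<mu> T ws F (B - {i}) = wedges \<mu> T ws (basis_form J) (B - {i}) * F J"
    proof (rule Cons.IH)
      have "B - {i} - J = B - J - {i}" by auto
      then show "card (B - {i} - J) = length ws" using Cons.prems that False by simp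
    qed (use Cons.prems False in auto)
    then show ?thesis by (simp add: mult.assoc)
  qed (use Cons.prems in simp)
  then show ?case by (simp add: wedge_def sum_distrib_right mult_scale_left)
qed

lemma wedges_not_distinct:
  assumes "q_manin \<mu> C Z" "\<mu> \<noteq> 0" "set ws \<subseteq> C" "\<not> distinct ws"
  shows "wedges \<mu> Z ws F = (\<lambda>K. 0)"
  using assms(3,4)
proof (induction ws)
  case (Cons x xs)
  show ?case
  proof (cases "x \<in> set xs")
    case True
    then show ?thesis using wedges_repeated[OF assms(1,2)] Cons.prems by blast
  next
    case False
    then show ?thesis using Cons by (simp add: wedge_zero)
  qed
qed simp


section \<open>The Manin relations and Schur complements\<close>

text \<open>The relation inside an even column gives the squares, the general exchange relation
  gives the rest. In each pair of rows from \<open>R\<close> the smaller one is even, so that all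
  signs are trivial even if \<open>R\<close> contains one odd row.\<close>

lemma q_manin_even_columns:
  assumes A: "super_manin scale G q r s A" and q: "q \<noteq> 0"
    and R: "R \<subseteq> {..<r+s}" "\<And>i k. i \<in> R \<Longrightarrow> k \<in> R \<Longrightarrow> i < k \<Longrightarrow> i < r"
  shows "q_manin (- inverse q) {..<r} (\<lambda>j i. if i \<in> R then A $$ (i,j) else 0)"
proof -
  have c1: "pairing (- inverse q) (\<lambda>i. A $$ (i,j)) (\<lambda>i. A $$ (i,j)) i k = 0"
    if "j < r" "i < r" "k < r + s" "i < k" for i j k
  proof -
    have "eps i k = -1" using that by (simp add: eps_def)
    moreover have "parity r j = 0" "parity r i = 0" using that by (simp_all add: parity_def)
    moreover have "parity r j = 0 \<longrightarrow> A $$ (i,j) * A $$ (k,j) =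
        scale (q powi eps i k * (-1) ^ (parity r i * parity r k)) (A $$ (k,j) * A $$ (i,j))"
      using A that unfolding super_manin_def by (meson trans_less_add1)
    ultimately show ?thesis
      by (simp add: pairing_def power_int_minus)
  qed
  have c2: "pairing (- inverse q) (\<lambda>i. A $$ (i,l)) (\<lambda>i. A $$ (i,j)) i k =
      scale (- inverse q) (pairing (- inverse q) (\<lambda>i. A $$ (i,j)) (\<lambda>i. A $$ (i,l)) i k)"
    if "j < r" "l < r" "j < l" "i < r" "k < r + s" "i < k" for i j k l
  proof -
    have e: "eps i k = -1" "eps l j = 1" using that by (simp_all add: eps_def)
    have p: "parity r j = 0" "parity r l = 0" "parity r i = 0" using that by (simp_all add: parity_def)
    have h: "A $$ (i,j) * A $$ (k,l)
        - scale (q powi (eps i k + eps l j)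
              * (-1) ^ ((parity r i + parity r j) * (parity r k + parity r l)))
            (A $$ (k,l) * A $$ (i,j))
      = scale (q powi eps i k
              * (-1) ^ (parity r i * parity r k + parity r j * parity r k
                        + parity r i * parity r j))
            (A $$ (k,j) * A $$ (i,l))
        - scale (q powi eps l j
              * (-1) ^ (parity r j * parity r k + parity r j * parity r l
                        + parity r k * parity r l))
            (A $$ (i,l) * A $$ (k,j))"
      using A that unfolding super_manin_def by (meson trans_less_add1)
    have "A $$ (i,j) * A $$ (k,l) = A $$ (k,l) * A $$ (i,j)
        + scale (inverse q) (A $$ (k,j) * A $$ (i,l)) - scale q (A $$ (i,l) * A $$ (k,j))"
      using h unfolding e p by (simp add: power_int_minus algebra_simps)
    then show ?thesis
      using q by (simp add: pairing_def scale_right_distrib scale_right_diff_distrib)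
  qed
  have lt: "i < r" "k < r + s" if "i \<in> R" "k \<in> R" "i < k" for i k
    using R that by auto
  show ?thesis
    unfolding q_manin_def
  proof (intro conjI ballI allI impI)
    fix j i k :: nat assume "j \<in> {..<r}" "i < k"
    then show "pairing (- inverse q) (\<lambda>i. if i \<in> R then A $$ (i,j) else 0)
        (\<lambda>i. if i \<in> R then A $$ (i,j) else 0) i k = 0"
      using c1[of j i k] lt[of i k] by (auto simp: pairing_def)
  next
    fix j l i k :: nat assume "j \<in> {..<r}" "l \<in> {..<r}" "j < l" "i < k"
    then show "pairing (- inverse q) (\<lambda>i. if i \<in> R then A $$ (i,l) else 0)
        (\<lambda>i. if i \<in> R then A $$ (i,j) else 0) i k =
      scale (- inverse q) (pairing (- inverse q) (\<lambda>i. if i \<in> R then A $$ (i,j) else 0)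
        (\<lambda>i. if i \<in> R then A $$ (i,l) else 0) i k)"
      using c2[of j l i k] lt[of i k] by (auto simp: pairing_def)
  qed
qed

text \<open>With rows in place of columns and \<open>inverse q\<close> in place of \<open>q\<close>,
  the relations of the odd block again lead to the parameter \<open>- inverse q\<close>. Hence both
  factors of the Berezinian are treated with the same \<mu>.\<close>

lemma q_manin_odd_rows:
  assumes A: "super_manin scale G (inverse q) r s A" and q: "q \<noteq> 0"
  shows "q_manin (- inverse q) {..<s} (\<lambda>j i. if i < s then A $$ (r + j, r + i) else 0)"
proof -
  have c1: "pairing (- inverse q) (\<lambda>i. A $$ (r + j, r + i)) (\<lambda>i. A $$ (r + j, r + i)) i k = 0"
    if "j < s" "k < s" "i < k" for i j k
  proof -
    have "eps (r + k) (r + i) = 1" using that by (simp add: eps_def)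
    moreover have "parity r (r + j) = 1 \<longrightarrow> A $$ (r + j,r + i) * A $$ (r + j, r + k) =
        scale (inverse q powi eps (r + k) (r + i) * (-1) ^ ((parity r (r + i) + 1) * (parity r (r + k) + 1)))
          (A $$ (r + j,r + k) * A $$ (r + j,r + i))"
      using A that unfolding super_manin_def by (meson add_less_cancel_left less_trans)
    ultimately show ?thesis
      by (simp add: pairing_def parity_def)
  qed
  have c2: "pairing (- inverse q) (\<lambda>i. A $$ (r + l, r + i)) (\<lambda>i. A $$ (r + j, r + i)) i k =
      scale (- inverse q) (pairing (- inverse q) (\<lambda>i. A $$ (r + j, r + i)) (\<lambda>i. A $$ (r + l, r + i)) i k)"
    if "l < s" "j < l" "k < s" "i < k" for i j k l
  proof -
    have e: "eps (r + j) (r + l) = -1" "eps (r + k) (r + i) = 1"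
      using that by (simp_all add: eps_def)
    have p: "parity r (r + x) = 1" for x by (simp add: parity_def)
    have lt: "r + i < r + s" "r + j < r + s" "r + k < r + s" "r + l < r + s" using that by auto
    have h: "A $$ (r + j,r + i) * A $$ (r + l,r + k)
        - scale (inverse q powi (eps (r + j) (r + l) + eps (r + k) (r + i))
              * (-1) ^ ((parity r (r + j) + parity r (r + i)) * (parity r (r + l) + parity r (r + k))))
            (A $$ (r + l,r + k) * A $$ (r + j,r + i))
      = scale (inverse q powi eps (r + j) (r + l)
              * (-1) ^ (parity r (r + j) * parity r (r + l) + parity r (r + i) * parity r (r + l)
                        + parity r (r + j) * parity r (r + i)))
            (A $$ (r + l,r + i) * A $$ (r + j,r + k))
        - scale (inverse q powi eps (r + k) (r + i)
              * (-1) ^ (parity r (r + i) * parity r (r + l) + parity r (r + i) * parity r (r + k)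
                        + parity r (r + l) * parity r (r + k)))
            (A $$ (r + j,r + k) * A $$ (r + l,r + i))"
      using A lt unfolding super_manin_def by meson
    have "A $$ (r + j,r + i) * A $$ (r + l,r + k) = A $$ (r + l,r + k) * A $$ (r + j,r + i)
        - scale q (A $$ (r + l,r + i) * A $$ (r + j,r + k))
        + scale (inverse q) (A $$ (r + j,r + k) * A $$ (r + l,r + i))"
      using h unfolding e p by (simp add: power_int_minus algebra_simps)
    then show ?thesis
      using q by (simp add: pairing_def scale_right_distrib scale_right_diff_distrib)
  qed
  show ?thesis
    unfolding q_manin_def
  proof (intro conjI ballI allI impI)
    fix j i k :: nat assume "j \<in> {..<s}" "i < k"
    then show "pairing (- inverse q) (\<lambda>i. if i < s then A $$ (r + j, r + i) else 0)
        (\<lambda>i. if i < s then A $$ (r + j, r + i) else 0) i k = 0"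
      using c1[of j k i] by (auto simp: pairing_def)
  next
    fix j l i k :: nat assume "j \<in> {..<s}" "l \<in> {..<s}" "j < l" "i < k"
    then show "pairing (- inverse q) (\<lambda>i. if i < s then A $$ (r + l, r + i) else 0)
        (\<lambda>i. if i < s then A $$ (r + j, r + i) else 0) i k =
      scale (- inverse q) (pairing (- inverse q) (\<lambda>i. if i < s then A $$ (r + j, r + i) else 0)
        (\<lambda>i. if i < s then A $$ (r + l, r + i) else 0) i k)"
      using c2[of l j k i] by (auto simp: pairing_def)
  qed
qed

text \<open>In the exchange relation for an even column \<open>j\<close> and an odd column
  \<open>a\<close>, the only sign belongs to the product of entry \<open>(i,a)\<close> with entry
  \<open>(k,j)\<close> and is -1 exactly for \<open>k = l\<close>. Negating \<open>Z j l\<close>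
  absorbs it.\<close>

lemma odd_column_pairing:
  assumes A: "super_manin scale G q r s A" and q: "q \<noteq> 0"
    and l: "r \<le> l" "l < r + s" and ja: "j < r" "r \<le> a" "a < r + s" and ik: "i < k"
  defines "Z \<equiv> \<lambda>j i. if i \<in> insert l {..<r} then A $$ (i,j) else 0"
  shows "pairing (- inverse q) (Z a) ((Z j)(l := - Z j l)) i k =
    scale (- inverse q) (pairing (- inverse q) (Z j) (Z a) i k)"
proof (cases "i < r \<and> (k < r \<or> k = l)")
  case False
  then show ?thesis using ik l by (auto simp: pairing_def Z_def)
next
  case True
  have e: "eps i k = -1" "eps a j = 1" using ja ik by (simp_all add: eps_def)
  have p: "parity r j = 0" "parity r a = 1" "parity r i = 0" using ja True by (simp_all add: parity_def)
  have h: "A $$ (i,j) * A $$ (k,a)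
      - scale (q powi (eps i k + eps a j)
            * (-1) ^ ((parity r i + parity r j) * (parity r k + parity r a)))
          (A $$ (k,a) * A $$ (i,j))
    = scale (q powi eps i k
            * (-1) ^ (parity r i * parity r k + parity r j * parity r k
                      + parity r i * parity r j))
          (A $$ (k,j) * A $$ (i,a))
      - scale (q powi eps a j
            * (-1) ^ (parity r j * parity r k + parity r j * parity r a
                      + parity r k * parity r a))
          (A $$ (i,a) * A $$ (k,j))"
    using A ja True l unfolding super_manin_def by (meson less_le_trans le_trans trans_less_add1)
  have h': "A $$ (i,j) * A $$ (k,a) = A $$ (k,a) * A $$ (i,j)
      + scale (inverse q) (A $$ (k,j) * A $$ (i,a))
      - scale (q * (-1) ^ parity r k) (A $$ (i,a) * A $$ (k,j))"
    using h unfolding e p by (simp add: power_int_minus algebra_simps)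
  have "i \<noteq> l" using True l by auto
  show ?thesis
  proof (cases "k = l")
    case True
    then have "parity r k = 1" using l by (simp add: parity_def)
    then show ?thesis
      using h' q True \<open>i < r \<and> _\<close> \<open>i \<noteq> l\<close>
      by (simp add: Z_def pairing_def scale_right_distrib scale_right_diff_distrib)
  next
    case False
    then have "parity r k = 0" using True by (simp add: parity_def)
    then show ?thesis
      using h' q True False \<open>i \<noteq> l\<close>
      by (simp add: Z_def pairing_def scale_right_distrib scale_right_diff_distrib)
  qed
qed

section \<open>Factorization of determinants along Schur complements\<close>

lemma wedges_split_sorted:
  assumes "q_manin \<mu> {..<r} Z" "A \<union> J = {..<r}" "A \<inter> J = {}"
  shows "wedges \<mu> Z (sorted_list_of_set A @ sorted_list_of_set J) F =
    (\<lambda>K. scale (\<mu> ^ cross_inversions A J) (wedges \<mu> Z [0..<r] F K))"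
proof -
  have fin: "finite A" "finite J" using assms(2) by (metis finite_Un finite_lessThan)+
  let ?ws = "sorted_list_of_set A @ sorted_list_of_set J"
  have st: "set ?ws = {..<r}" "distinct ?ws" using fin assms by auto
  have "sort ?ws = [0..<r]"
    by (rule sorted_distinct_set_unique) (use st in \<open>auto simp: atLeast0LessThan\<close>)
  moreover have "list_inversions ?ws = cross_inversions A J"
    using list_inversions_append[OF st(2)] fin by (simp add: list_inversions_sorted)
  moreover have "set ?ws \<subseteq> {..<r}" by (simp only: st(1))
  ultimately show ?thesis using wedges_sort[OF assms(1) _ st(2)] by simp
qed

lemma wedges_support:
  assumes "wedges \<mu> T ws (basis_form {}) K \<noteq> 0" "\<And>j i. j \<in> set ws \<Longrightarrow> i \<notin> J \<Longrightarrow> T j i = 0"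
  shows "finite K \<and> K \<subseteq> J \<and> card K = length ws"
  using assms
proof (induction ws arbitrary: K)
  case Nil
  then show ?case by (simp add: basis_form_def split: if_splits)
next
  case (Cons w ws)
  have fin: "finite K" using Cons.prems(1) wedge_infinite by auto
  obtain i where i: "i \<in> K" "T w i * wedges \<mu> T ws (basis_form {}) (K - {i}) \<noteq> 0"
    using Cons.prems(1) unfolding wedges.simps wedge_def
    by (metis (no_types, lifting) scale_zero_right sum.neutral)
  then have "T w i \<noteq> 0" "wedges \<mu> T ws (basis_form {}) (K - {i}) \<noteq> 0" by auto
  then have "i \<in> J" "K - {i} \<subseteq> J" "card (K - {i}) = length ws"
    using Cons.prems(2)[of w i] Cons.IH[of "K - {i}"] Cons.prems(2) by auto
  then show ?case using i(1) fin card_Suc_Diff1[OF fin i(1)] by auto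
qed

text \<open>The coefficients \<open>c a j\<close> stand on the right and can be absorbed into the
  form behind them, so the vectors are replaced from the last one backwards. The terms with
  \<open>Z a\<close> repeat a factor and vanish.\<close>

lemma qdet_schur_right:
  assumes Z: "q_manin \<mu> {..<r} Z" and \<mu>: "\<mu> \<noteq> 0"
    and AJ: "A \<union> J = {..<r}" "A \<inter> J = {}"
    and dec: "\<And>j. j \<in> J \<Longrightarrow> Z j = (\<lambda>i. T j i + (\<Sum>a\<in>A. Z a i * c a j))"
    and T0: "\<And>j i. j \<in> J \<Longrightarrow> i \<notin> J \<Longrightarrow> T j i = 0"
  shows "qdet \<mu> r Z = wedges \<mu> Z (sorted_list_of_set A) (basis_form {}) A *
    wedges \<mu> T (sorted_list_of_set J) (basis_form {}) J"
proof -
  have fin: "finite A" "finite J" using AJ(1) by (metis finite_Un finite_lessThan)+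
  let ?As = "sorted_list_of_set A" and ?Js = "sorted_list_of_set J"
  have replace: "wedges \<mu> Z ?As (wedges \<mu> Z js F) = wedges \<mu> Z ?As (wedges \<mu> T js F)"
    if "set js \<subseteq> J" for js F
    using that
  proof (induction js arbitrary: F rule: rev_induct)
    case (snoc j js)
    then have j: "j \<in> J" and js: "set js \<subseteq> J" by auto
    \<comment> \<open>The induction hypothesis is read backwards: turning \<open>T\<close> into
      \<open>Z\<close> again makes the repetition of \<open>Z a\<close> visible.\<close>
    have zero: "wedges \<mu> Z ?As (wedges \<mu> T js (wedge \<mu> (Z a) F')) = (\<lambda>K. 0)" if "a \<in> A" for a F'
    proof -
      have "wedges \<mu> Z (?As @ js @ [a]) F' = (\<lambda>K. 0)"
        by (rule wedges_not_distinct[OF Z \<mu>]) (use that js AJ fin in auto)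
      then show ?thesis by (simp add: snoc.IH[OF js, symmetric] wedges_append)
    qed
    have "wedge \<mu> (Z j) F = (\<lambda>K. wedge \<mu> (T j) F K + (\<Sum>a\<in>A. wedge \<mu> (Z a) (\<lambda>K. c a j * F K) K))"
      by (subst dec[OF j]) (simp only: wedge_column_add wedge_column_sum wedge_column_mult_right)
    then have "wedges \<mu> Z ?As (wedges \<mu> T js (wedge \<mu> (Z j) F)) =
        wedges \<mu> Z ?As (wedges \<mu> T js (wedge \<mu> (T j) F))"
      by (simp add: wedges_add wedges_sum zero)
    then show ?case by (simp add: wedges_append snoc.IH[OF js])
  qed simp
  define H where "H = wedges \<mu> T ?Js (basis_form {})"
  \<comment> \<open>A product of \<open>card J\<close> vectors supported on \<open>J\<close> is a
    multiple of the top monomial \<open>\<psi>\<^sub>J\<close>.\<close>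
  have "H K = basis_form J K * H J" for K
  proof (cases "K = J")
    case False
    have "H K = 0"
    proof (rule ccontr)
      assume "H K \<noteq> 0"
      from wedges_support[OF this[unfolded H_def], of J] have "K \<subseteq> J" "card K = card J"
        using T0 fin by auto
      then show False using False card_subset_eq[OF fin(2)] by auto
    qed
    then show ?thesis using False by (simp add: basis_form_def)
  qed (simp add: basis_form_def)
  then have H: "H = (\<lambda>K. basis_form J K * H J)" by blast
  have "scale (\<mu> ^ cross_inversions A J) (qdet \<mu> r Z) = wedges \<mu> Z ?As H {..<r}"
    using fun_cong[OF wedges_split_sorted[OF Z AJ], of "basis_form {}" "{..<r}"] replace[of ?Js] fin
    by (simp add: qdet_eq_wedges wedges_append H_def)
  also have "\<dots> = wedges \<mu> Z ?As (basis_form J) {..<r} * H J"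
    by (subst H) (simp add: wedges_mult_right)
  also have "wedges \<mu> Z ?As (basis_form J) {..<r} =
      scale (\<mu> ^ cross_inversions A J) (wedges \<mu> Z ?As (basis_form {}) A)"
  proof -
    have "{..<r} - J = A" "J \<subseteq> {..<r}" using AJ by auto
    then show ?thesis by (simp add: wedges_basis_form)
  qed
  finally show ?thesis using \<mu> by (simp add: mult_scale_left H_def)
qed

text \<open>The coefficients now stand on the left and come out in front, so the vectors are
  replaced starting next to the \<open>J\<close>-factors. A term with \<open>Z a\<close> repeats one
  of these factors and vanishes.\<close>

lemma qdet_schur_left:
  assumes Z: "q_manin \<mu> {..<r} Z" and \<mu>: "\<mu> \<noteq> 0"
    and AJ: "A \<union> J = {..<r}" "A \<inter> J = {}"
    and dec: "\<And>j. j \<in> A \<Longrightarrow> Z j = (\<lambda>i. T j i + (\<Sum>a\<in>J. c j a * Z a i))"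
    and T0: "\<And>j i. j \<in> A \<Longrightarrow> i \<in> J \<Longrightarrow> T j i = 0"
  shows "qdet \<mu> r Z = wedges \<mu> T (sorted_list_of_set A) (basis_form {}) A *
    wedges \<mu> Z (sorted_list_of_set J) (basis_form {}) J"
proof -
  have fin: "finite A" "finite J" using AJ(1) by (metis finite_Un finite_lessThan)+
  let ?As = "sorted_list_of_set A" and ?Js = "sorted_list_of_set J"
  define F where "F = wedges \<mu> Z ?Js (basis_form {})"
  have replace: "wedges \<mu> Z js F = wedges \<mu> T js F" if "set js \<subseteq> A" for js
    using that
  proof (induction js)
    case (Cons j js)
    then have j: "j \<in> A" and js: "set js \<subseteq> A" by auto
    have zero: "wedge \<mu> (Z a) (wedges \<mu> T js F) = (\<lambda>K. 0)" if "a \<in> J" for a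
    proof -
      have "wedges \<mu> Z (a # js @ ?Js) (basis_form {}) = (\<lambda>K. 0)"
        by (rule wedges_not_distinct[OF Z \<mu>]) (use that js AJ fin in auto)
      then have "wedge \<mu> (Z a) (wedges \<mu> Z js F) = (\<lambda>K. 0)" by (simp add: wedges_append F_def)
      then show ?thesis by (simp only: Cons.IH[OF js])
    qed
    show ?case
      unfolding wedges.simps Cons.IH[OF js]
      by (subst dec[OF j]) (simp add: wedge_column_add wedge_column_sum wedge_column_mult_left zero)
  qed simp
  have eq: "{..<r} - J = A" "J \<subseteq> {..<r}" using AJ by auto
  have "scale (\<mu> ^ cross_inversions A J) (qdet \<mu> r Z) = wedges \<mu> T ?As F {..<r}"
    using fun_cong[OF wedges_split_sorted[OF Z AJ], of "basis_form {}" "{..<r}"] replace[of ?As] fin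
    by (simp add: qdet_eq_wedges wedges_append F_def)
  also have "\<dots> = wedges \<mu> T ?As (basis_form J) {..<r} * F J"
    by (rule wedges_supported) (use eq T0 fin in auto)
  also have "wedges \<mu> T ?As (basis_form J) {..<r} =
      scale (\<mu> ^ cross_inversions A J) (wedges \<mu> T ?As (basis_form {}) A)"
    using eq by (simp add: wedges_basis_form)
  finally show ?thesis using \<mu> by (simp add: mult_scale_left F_def)
qed

end

section \<open>Supertransposes and block inversion\<close>

text \<open>
  For odd \<open>a\<close> the coefficients of \<open>\<Psi>\<^sub>a\<close> at the even \<open>\<psi>\<^sub>i\<close> are odd, and change sign when they are moved
  past an odd \<open>\<psi>\<^sub>l\<close>. If \<open>l\<close> is the only odd row, multiplication by \<open>\<Psi>\<^sub>a\<close> is \<open>wedge\<close> after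
  \<open>flip_sign l\<close>, since the remaining coefficient at \<open>\<psi>\<^sub>l\<close> only meets sets without \<open>l\<close>.
\<close>

definition flip_sign :: "nat \<Rightarrow> (nat set \<Rightarrow> 'a::ring_1) \<Rightarrow> nat set \<Rightarrow> 'a"
  where "flip_sign l F K = (if l \<in> K then - F K else F K)"

text \<open>Extended by zero, because \<open>q_manin\<close> quantifies over all pairs of
  indices.\<close>

definition even_columns :: "nat \<Rightarrow> 'a::zero mat \<Rightarrow> nat \<Rightarrow> nat \<Rightarrow> 'a"
  where "even_columns r A = (\<lambda>j i. if i \<in> {..<r} then A $$ (i,j) else 0)"

definition odd_rows :: "nat \<Rightarrow> nat \<Rightarrow> 'a::zero mat \<Rightarrow> nat \<Rightarrow> nat \<Rightarrow> 'a"
  where "odd_rows r s A = (\<lambda>j i. if i < s then A $$ (r + j, r + i) else 0)"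

text \<open>For \<open>x\<close> in \<open>A\<close>, the position at which row or column
  \<open>x\<close> appears in a \<open>submatrix\<close> with index set \<open>A\<close>.\<close>

definition rank :: "nat set \<Rightarrow> nat \<Rightarrow> nat"
  where "rank A x = card {a\<in>A. a < x}"

lemma rank_strict_mono:
  assumes "finite A" "x \<in> A" "x < y"
  shows "rank A x < rank A y"
  unfolding rank_def by (rule psubset_card_mono) (use assms in auto)

lemma rank_strict_mono_on: "finite A \<Longrightarrow> strict_mono_on A (rank A)"
  by (rule strict_mono_onI) (rule rank_strict_mono)

lemma rank_image:
  assumes "finite A"
  shows "rank A ` A = {..<card A}"
proof (rule card_subset_eq)
  show "rank A ` A \<subseteq> {..<card A}"
    unfolding rank_def using assms by (auto intro!: psubset_card_mono)
  show "card (rank A ` A) = card {..<card A}"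
    using strict_mono_on_imp_inj_on[OF rank_strict_mono_on[OF assms]] by (simp add: card_image)
qed simp

lemma rank_less_card: "finite A \<Longrightarrow> x \<in> A \<Longrightarrow> rank A x < card A"
  using rank_image by blast

lemma rank_eq_iff: "finite A \<Longrightarrow> x \<in> A \<Longrightarrow> y \<in> A \<Longrightarrow> rank A x = rank A y \<longleftrightarrow> x = y"
  by (meson inj_on_eq_iff rank_strict_mono_on strict_mono_on_imp_inj_on)

lemma map_rank_sorted_list_of_set:
  assumes "finite A"
  shows "map (rank A) (sorted_list_of_set A) = [0..<card A]"
proof (rule sorted_distinct_set_unique)
  have "sorted_wrt (<) (map (rank A) (sorted_list_of_set A))"
    using assms by (auto simp: sorted_wrt_map intro!: rank_strict_mono
        sorted_wrt_mono_rel[OF _ strict_sorted_list_of_set])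
  then show "sorted (map (rank A) (sorted_list_of_set A))" "distinct (map (rank A) (sorted_list_of_set A))"
    using strict_sorted_iff by blast+
qed (use assms in \<open>auto simp: rank_image\<close>)

lemma sum_rank: "finite A \<Longrightarrow> (\<Sum>x\<in>A. f (rank A x)) = (\<Sum>k<card A. f k)"
  by (rule sum.reindex_bij_betw)
     (simp add: bij_betw_def rank_image strict_mono_on_imp_inj_on[OF rank_strict_mono_on])

section \<open>Inverse relations between entries\<close>

lemma inverts_mat_sum:
  assumes "inverts_mat A B" "A \<in> carrier_mat N N" "B \<in> carrier_mat N N" "i < N" "j < N"
  shows "(\<Sum>k<N. A $$ (i,k) * B $$ (k,j)) = (if i = j then 1 else 0)"
proof -
  have "(A * B) $$ (i,j) = (if i = j then 1 else 0)"
    using assms by (simp add: inverts_mat_def)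
  then show ?thesis
    using assms by (simp add: scalar_prod_def atLeast0LessThan)
qed

lemma inverts_mat_rank_sum:
  assumes "inverts_mat A B" "A \<in> carrier_mat (card J) (card J)" "B \<in> carrier_mat (card J) (card J)"
    and "finite J" "x \<in> J" "y \<in> J"
  shows "(\<Sum>z\<in>J. A $$ (rank J x, rank J z) * B $$ (rank J z, rank J y)) = (if x = y then 1 else 0)"
  unfolding sum_rank[OF assms(4), of "\<lambda>k. A $$ (rank J x, k) * B $$ (k, rank J y)"]
    inverts_mat_sum[OF assms(1-3) rank_less_card[OF assms(4,5)] rank_less_card[OF assms(4,6)]]
  by (simp only: rank_eq_iff[OF assms(4-6)])

text \<open>Inverse supertransposes allow a contraction over the row index of the left factor and
  the column index of the right one. For odd \<open>b\<close> and even \<open>i\<close> the two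
  signs multiply to a constant, which drops out.\<close>

lemma supertranspose_inverts_odd_even:
  fixes A B :: "'a::ring_1 mat"
  assumes "inverts_mat (supertranspose r A) (supertranspose r B)"
    and "A \<in> carrier_mat (r+s) (r+s)" "B \<in> carrier_mat (r+s) (r+s)"
    and "r \<le> b" "b < r + s" "i < r"
  shows "(\<Sum>a<r+s. A $$ (a,b) * B $$ (i,a)) = 0"
proof -
  have "(\<Sum>a<r+s. supertranspose r A $$ (b,a) * supertranspose r B $$ (a,i)) = 0"
    using inverts_mat_sum[OF assms(1), of "r+s" b i] assms(2-) by (auto simp: supertranspose_def)
  moreover have "supertranspose r A $$ (b,a) * supertranspose r B $$ (a,i) = - (A $$ (a,b) * B $$ (i,a))"
    if "a < r + s" for a
    using assms that by (auto simp: supertranspose_def parity_def)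
  ultimately show ?thesis by (simp add: sum_negf)
qed

lemma supertranspose_inverts_odd_odd:
  fixes A B :: "'a::ring_1 mat"
  assumes "inverts_mat (supertranspose r A) (supertranspose r B)"
    and "A \<in> carrier_mat (r+s) (r+s)" "B \<in> carrier_mat (r+s) (r+s)"
    and "r \<le> b" "b < r + s" "r \<le> i" "i < r + s"
  shows "(\<Sum>a<r+s. A $$ (a,b) * (if a < r then - B $$ (i,a) else B $$ (i,a))) = (if b = i then 1 else 0)"
proof -
  have "(\<Sum>a<r+s. supertranspose r A $$ (b,a) * supertranspose r B $$ (a,i)) = (if b = i then 1 else 0)"
    by (rule inverts_mat_sum[OF assms(1)]) (use assms(2-) in \<open>auto simp: supertranspose_def\<close>)
  moreover have "supertranspose r A $$ (b,a) * supertranspose r B $$ (a,i) =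
      A $$ (a,b) * (if a < r then - B $$ (i,a) else B $$ (i,a))"
    if "a < r + s" for a
    using assms that by (auto simp: supertranspose_def parity_def)
  ultimately show ?thesis by simp
qed

text \<open>
  Here \<open>B\<close> is the inverse of \<open>M\<close> and \<open>N\<close> the inverse of its \<open>J\<close>-block, so that \<open>N\<close> is the Schur
  complement in \<open>M\<close> of its complementary block.
\<close>

lemma schur_columns:
  fixes M B N :: "nat \<Rightarrow> nat \<Rightarrow> 'a::ring_1"
  assumes "finite U" "J \<subseteq> U" "i \<in> U" "j \<in> J"
    and MB: "\<And>x. x \<in> U \<Longrightarrow> (\<Sum>y\<in>U. M i y * B y x) = (if i = x then 1 else 0)"
    and BN: "\<And>y. y \<in> J \<Longrightarrow> (\<Sum>x\<in>J. B y x * N x j) = (if y = j then 1 else 0)"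
  shows "M i j = (if i \<in> J then N i j else 0) + (\<Sum>a\<in>U - J. M i a * - (\<Sum>x\<in>J. B a x * N x j))"
proof -
  \<comment> \<open>On \<open>J\<close> this is the unit vector at \<open>j\<close>, so the part of
    the sum over \<open>J\<close> collapses to \<open>M i j\<close>; the other columns give the
    correction.\<close>
  define W where "W = (\<lambda>y. \<Sum>x\<in>J. B y x * N x j)"
  have J: "finite J" using assms(1,2) finite_subset by blast
  have "(\<Sum>y\<in>U. M i y * W y) = (\<Sum>x\<in>J. (\<Sum>y\<in>U. M i y * B y x) * N x j)"
    unfolding W_def sum_distrib_left sum_distrib_right
    by (subst sum.swap) (simp add: mult.assoc)
  also have "\<dots> = (\<Sum>x\<in>J. if i = x then N x j else 0)"
    by (rule sum.cong) (use assms in \<open>auto simp: MB subset_iff\<close>)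
  also have "\<dots> = (if i \<in> J then N i j else 0)" using J by simp
  finally have "(if i \<in> J then N i j else 0) = (\<Sum>y\<in>U - J. M i y * W y) + (\<Sum>y\<in>J. M i y * W y)"
    using sum.subset_diff[OF assms(2,1), of "\<lambda>y. M i y * W y"] by simp
  also have "(\<Sum>y\<in>J. M i y * W y) = (\<Sum>y\<in>J. if y = j then M i y else 0)"
    by (rule sum.cong) (auto simp: W_def BN)
  also have "\<dots> = M i j" using J assms(4) by simp
  finally show ?thesis by (simp add: W_def sum_negf)
qed

text \<open>Mirror image of \<open>schur_columns\<close>: the coefficients stand on the left, as
  \<open>qdet_schur_left\<close> requires.\<close>

lemma schur_rows:
  fixes M B N :: "nat \<Rightarrow> nat \<Rightarrow> 'a::ring_1"
  assumes "finite U" "J \<subseteq> U" "i \<in> U" "j \<in> J"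
    and MB: "\<And>x. x \<in> U \<Longrightarrow> (\<Sum>y\<in>U. B x y * M y i) = (if x = i then 1 else 0)"
    and BN: "\<And>y. y \<in> J \<Longrightarrow> (\<Sum>x\<in>J. N j x * B x y) = (if j = y then 1 else 0)"
  shows "M j i = (if i \<in> J then N j i else 0) + (\<Sum>a\<in>U - J. - (\<Sum>x\<in>J. N j x * B x a) * M a i)"
proof -
  define W where "W = (\<lambda>y. \<Sum>x\<in>J. N j x * B x y)"
  have J: "finite J" using assms(1,2) finite_subset by blast
  have "(\<Sum>y\<in>U. W y * M y i) = (\<Sum>x\<in>J. N j x * (\<Sum>y\<in>U. B x y * M y i))"
    unfolding W_def sum_distrib_left sum_distrib_right
    by (subst sum.swap) (simp add: mult.assoc)
  also have "\<dots> = (\<Sum>x\<in>J. if x = i then N j x else 0)"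
    by (rule sum.cong) (use assms in \<open>auto simp: MB subset_iff\<close>)
  also have "\<dots> = (if i \<in> J then N j i else 0)" using J by simp
  finally have "(if i \<in> J then N j i else 0) = (\<Sum>y\<in>U - J. W y * M y i) + (\<Sum>y\<in>J. W y * M y i)"
    using sum.subset_diff[OF assms(2,1), of "\<lambda>y. W y * M y i"] by simp
  also have "(\<Sum>y\<in>J. W y * M y i) = (\<Sum>y\<in>J. if j = y then M y i else 0)"
    by (rule sum.cong) (auto simp: W_def BN)
  also have "\<dots> = M j i" using J assms(4) by simp
  finally show ?thesis by (simp add: W_def sum_negf)
qed

context unital_algebra
begin

lemma qdet_0 [simp]: "qdet \<mu> 0 Z = 1"
  by (simp add: qdet_eq_wedges basis_form_def)

lemma qdet_cong:
  assumes "\<And>j i. j < r \<Longrightarrow> i < r \<Longrightarrow> Z j i = Z' j i"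
  shows "qdet \<mu> r Z = qdet \<mu> r Z'"
  unfolding qdet_def
proof (intro sum.cong refl arg_cong2[where f = scale] arg_cong[of _ _ prod_list] map_cong)
  fix \<sigma> j assume "\<sigma> \<in> {\<sigma>. \<sigma> permutes {..<r}}" "j \<in> set [0..<r]"
  then show "Z j (\<sigma> j) = Z' j (\<sigma> j)"
    using permutes_in_image[of \<sigma> "{..<r}" j] by (auto intro: assms)
qed

text \<open>An increasing relabelling preserves all powers of \<mu>, so minors can be computed with
  the original indices.\<close>

lemma qdet_rank:
  assumes "finite A" "\<And>j i. j \<in> A \<Longrightarrow> i \<in> A \<Longrightarrow> Z j i = Z' (rank A j) (rank A i)"
  shows "qdet \<mu> (card A) Z' = wedges \<mu> Z (sorted_list_of_set A) (basis_form {}) A"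
  unfolding qdet_eq_wedges rank_image[OF assms(1), symmetric]
    map_rank_sorted_list_of_set[OF assms(1), symmetric]
  by (rule wedges_relabel[symmetric, OF _ subset_refl rank_strict_mono_on])
     (use assms in auto)

lemma qdet_commute:
  assumes "\<And>j i. j < r \<Longrightarrow> i < r \<Longrightarrow> c * Z j i = Z j i * c"
  shows "c * qdet \<mu> r Z = qdet \<mu> r Z * c"
proof -
  have pl: "c * prod_list xs = prod_list xs * c" if "\<And>x. x \<in> set xs \<Longrightarrow> c * x = x * c" for xs
    using that
  proof (induction xs)
    case (Cons x xs)
    have "c * (x * prod_list xs) = x * (c * prod_list xs)"
      using Cons.prems[of x] by (simp flip: mult.assoc)
    then show ?case using Cons by (simp add: mult.assoc)
  qed simp
  have "c * prod_list (map (\<lambda>j. Z j (\<sigma> j)) [0..<r]) = prod_list (map (\<lambda>j. Z j (\<sigma> j)) [0..<r]) * c"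
    if "\<sigma> permutes {..<r}" for \<sigma>
  proof (rule pl)
    fix x assume "x \<in> set (map (\<lambda>j. Z j (\<sigma> j)) [0..<r])"
    then obtain j where "j < r" "x = Z j (\<sigma> j)" by auto
    moreover have "\<sigma> j < r" using permutes_in_image[OF that, of j] \<open>j < r\<close> by simp
    ultimately show "c * x = x * c" by (simp add: assms)
  qed
  then show ?thesis
    by (simp add: qdet_def sum_distrib_left sum_distrib_right mult_scale_left mult_scale_right)
qed

section \<open>Commutation of the even determinant with the odd block of the inverse\<close>

lemma wedge_basis_form:
  assumes "finite R" "\<And>i. i \<notin> R \<Longrightarrow> v i = 0"
  shows "wedge \<mu> v (basis_form {}) = (\<lambda>K. \<Sum>i\<in>R. basis_form {i} K * v i)"
proof
  fix K :: "nat set"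
  show "wedge \<mu> v (basis_form {}) K = (\<Sum>i\<in>R. basis_form {i} K * v i)"
  proof (cases "\<exists>k. K = {k}")
    case True
    then obtain k where K: "K = {k}" by blast
    have none: "{x. x = k \<and> x < k} = {}" by auto
    have "wedge \<mu> v (basis_form {}) K = v k"
      by (simp add: K wedge_def basis_form_def none)
    also have "\<dots> = (\<Sum>i\<in>R. if k = i then v i else 0)" using assms by simp
    finally show ?thesis by (auto simp: K basis_form_def intro!: sum.cong)
  next
    case False
    then have "K - {i} \<noteq> {}" if "i \<in> K" for i using that by auto
    then have "wedge \<mu> v (basis_form {}) K = 0"
      by (auto simp: wedge_def basis_form_def intro!: sum.neutral)
    then show ?thesis using False by (auto simp: basis_form_def intro!: sum.neutral)
  qed
qed

text \<open>\<open>flip_sign l\<close> is the automorphism that sends \<open>\<psi>\<^sub>l\<close>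
  to its negative.\<close>

lemma flip_sign_wedge: "flip_sign l (wedge \<mu> u F) = wedge \<mu> (u(l := - u l)) (flip_sign l F)"
proof
  fix K :: "nat set"
  show "flip_sign l (wedge \<mu> u F) K = wedge \<mu> (u(l := - u l)) (flip_sign l F) K"
    unfolding flip_sign_def wedge_def
    by (auto simp flip: sum_negf simp: scale_minus_right intro!: sum.cong)
qed

text \<open>The vector \<open>v\<close> moves to the right through the product, taking one \<mu>
  from each factor and undoing its sign change at \<open>l\<close>.\<close>

lemma wedge_flip_sign_wedges:
  assumes "\<And>j i k. j \<in> set ws \<Longrightarrow> i < k \<Longrightarrow>
    pairing \<mu> v ((Z j)(l := - Z j l)) i k = scale \<mu> (pairing \<mu> (Z j) v i k)"
  shows "wedge \<mu> v (flip_sign l (wedges \<mu> Z ws F)) =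
    (\<lambda>K. scale (\<mu> ^ length ws) (wedges \<mu> Z ws (wedge \<mu> v (flip_sign l F)) K))"
  using assms
proof (induction ws)
  case (Cons w ws)
  have "wedge \<mu> v (flip_sign l (wedges \<mu> Z (w # ws) F)) =
      (\<lambda>K. scale \<mu> (wedge \<mu> (Z w) (wedge \<mu> v (flip_sign l (wedges \<mu> Z ws F))) K))"
    by (simp only: wedges.simps flip_sign_wedge) (rule wedge_swap, simp add: Cons.prems)
  also have "wedge \<mu> v (flip_sign l (wedges \<mu> Z ws F)) =
      (\<lambda>K. scale (\<mu> ^ length ws) (wedges \<mu> Z ws (wedge \<mu> v (flip_sign l F)) K))"
    by (rule Cons.IH, rule Cons.prems) simp_all
  finally show ?case by (simp add: wedge_scale)
qed simp


text \<open>
  \<open>Q a\<close> is the coefficient of \<open>\<psi>\<^sub>0 \<dots> \<psi>\<^bsub>r-1\<^esub> \<psi>\<^sub>l\<close> in \<open>\<Psi>\<^sub>0 \<dots> \<Psi>\<^bsub>r-1\<^esub> \<Psi>\<^sub>a\<close>, where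
  \<open>\<Psi>\<^sub>a = \<Sum>\<^sub>i \<psi>\<^sub>i A\<^sub>i\<^sub>a\<close>. It vanishes for even \<open>a\<close>, while for odd \<open>a\<close> the factor \<open>\<Psi>\<^sub>a\<close> can be moved
  to the front. Expanding in both ways along \<open>\<Psi>\<^sub>a\<close> shows that \<open>Q\<close> is a left and a right multiple
  of the even determinant.
\<close>

lemma even_minors_with_odd_row:
  assumes A: "super_manin scale G q r s A" and q: "q \<noteq> 0"
    and Y: "Y \<in> carrier_mat (r+s) (r+s)"
    and inv: "inverts_mat A Y" "inverts_mat (supertranspose r Y) (supertranspose r A)"
    and l: "r \<le> l" "l < r + s"
  obtains Q where
    "\<And>b. r \<le> b \<Longrightarrow> b < r + s \<Longrightarrow> (\<Sum>a\<in>{r..<r+s}. Q a * Y $$ (a,b)) =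
      (if b = l then qdet (- inverse q) r (even_columns r A) else 0)"
    "\<And>b. r \<le> b \<Longrightarrow> b < r + s \<Longrightarrow> (\<Sum>a\<in>{r..<r+s}. Y $$ (a,b) * Q a) =
      (if b = l then qdet (- inverse q) r (even_columns r A) else 0)"
proof -
  define \<mu> where "\<mu> = - inverse q"
  have \<mu>: "\<mu> \<noteq> 0" using q by (simp add: \<mu>_def)
  have carr: "A \<in> carrier_mat (r+s) (r+s)" using A by (simp add: super_manin_def)
  define K where "K = insert l {..<r}"
  define Z where "Z = (\<lambda>j i. if i \<in> K then A $$ (i,j) else 0)"
  define D where "D = qdet \<mu> r (even_columns r A)"
  define W where "W = wedges \<mu> Z [0..<r]"
  define Q where "Q = (\<lambda>a. W (wedge \<mu> (Z a) (basis_form {})) K)"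
  define P where "P = (\<lambda>i. W (basis_form {}) (K - {i}))"
  have K: "finite K" "K - {l} = {..<r}" using l by (auto simp: K_def)
  have sumK: "(\<Sum>i\<in>K. f i) = f l + (\<Sum>i<r. f i)" for f :: "nat \<Rightarrow> 'a"
    unfolding K_def using l by simp
  have manin: "q_manin \<mu> {..<r} Z"
    unfolding \<mu>_def Z_def K_def by (rule q_manin_even_columns[OF A q]) (use l in auto)
  have "D = qdet \<mu> r Z"
    unfolding D_def by (rule qdet_cong) (auto simp: Z_def K_def even_columns_def)
  then have D: "D = W (basis_form {}) {..<r}" by (simp add: qdet_eq_wedges W_def)
  have cross: "cross_inversions {..<r} {l} = 0" by (rule cross_inversions_eq_0) (use l in auto)
  have "{l} \<subseteq> K" by (simp add: K_def)
  then have D_l: "W (basis_form {l}) K = D"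
    unfolding W_def wedges_basis_form[OF K(1)] K(2) cross D by simp
  \<comment> \<open>For even \<open>a\<close> the vector \<open>Z a\<close> already occurs among the
    factors.\<close>
  have Q_even: "Q a = 0" if "a < r" for a
  proof -
    have "wedges \<mu> Z ([0..<r] @ [a]) (basis_form {}) = (\<lambda>K. 0)"
      by (rule wedges_not_distinct[OF manin \<mu>]) (use that in auto)
    then show ?thesis by (simp add: Q_def W_def wedges_append)
  qed
  have Q_right: "Q a = (\<Sum>i\<in>K. W (basis_form {i}) K * A $$ (i,a))" for a
  proof -
    have "wedge \<mu> (Z a) (basis_form {}) = (\<lambda>L. \<Sum>i\<in>K. basis_form {i} L * Z a i)"
      by (rule wedge_basis_form) (use K in \<open>auto simp: Z_def\<close>)
    then show ?thesis
      by (simp add: Q_def W_def wedges_sum wedges_mult_right) (simp add: Z_def)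
  qed
  \<comment> \<open>Expansion along a vector in front; \<open>l\<close> lies above all
    \<open>r\<close> even rows, hence the power \<open>\<mu> ^ r\<close>.\<close>
  have expand: "wedge \<mu> (Z a) F K = scale (\<mu> ^ r) (A $$ (l,a) * F {..<r}) +
      (\<Sum>i<r. scale (\<mu> ^ i) (A $$ (i,a) * F (K - {i})))" for a F
  proof -
    have "card {k \<in> K. k < i} = i" if "i < r" for i
    proof -
      have "{k \<in> K. k < i} = {..<i}" using that l by (auto simp: K_def)
      then show ?thesis by simp
    qed
    moreover have "{k \<in> K. k < l} = {..<r}" using l by (auto simp: K_def)
    ultimately show ?thesis
      unfolding wedge_def sumK K(2) by (simp add: Z_def K_def)
  qed
  have even: "scale (\<mu> ^ r) (A $$ (l,a) * D) + (\<Sum>i<r. scale (\<mu> ^ i) (A $$ (i,a) * P i)) = 0"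
    if "a < r" for a
  proof -
    have "wedges \<mu> Z (a # [0..<r]) (basis_form {}) = (\<lambda>K. 0)"
      by (rule wedges_repeated[OF manin \<mu>]) (use that in auto)
    then have "wedge \<mu> (Z a) (W (basis_form {})) K = 0" by (simp add: W_def)
    then show ?thesis by (simp add: expand D P_def)
  qed
  have odd: "scale (\<mu> ^ r) (Q a) =
      scale (\<mu> ^ r) (A $$ (l,a) * D) - (\<Sum>i<r. scale (\<mu> ^ i) (A $$ (i,a) * P i))"
    if a: "r \<le> a" "a < r + s" for a
  proof -
    have flip: "flip_sign l (basis_form {}) = (basis_form {} :: nat set \<Rightarrow> 'a)"
      by (rule ext) (auto simp: flip_sign_def basis_form_def)
    have "wedge \<mu> (Z a) (flip_sign l (W (basis_form {}))) =
        (\<lambda>K. scale (\<mu> ^ length [0..<r]) (W (wedge \<mu> (Z a) (flip_sign l (basis_form {}))) K))"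
      unfolding W_def
    proof (rule wedge_flip_sign_wedges)
      fix j i k :: nat assume "j \<in> set [0..<r]" "i < k"
      then show "pairing \<mu> (Z a) ((Z j)(l := - Z j l)) i k = scale \<mu> (pairing \<mu> (Z j) (Z a) i k)"
        using odd_column_pairing[OF A q l _ a] by (simp add: \<mu>_def Z_def K_def)
    qed
    then have "scale (\<mu> ^ r) (Q a) = wedge \<mu> (Z a) (flip_sign l (W (basis_form {}))) K"
      by (simp add: flip Q_def)
    also have "\<dots> = scale (\<mu> ^ r) (A $$ (l,a) * D) - (\<Sum>i<r. scale (\<mu> ^ i) (A $$ (i,a) * P i))"
    proof -
      have "flip_sign l (W (basis_form {})) {..<r} = D"
        using l by (simp add: flip_sign_def D)
      \<comment> \<open>For \<open>i < r\<close> the set \<open>K - {i}\<close> still contains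
        \<open>l\<close>, whence the minus sign.\<close>
      moreover have "flip_sign l (W (basis_form {})) (K - {i}) = - P i" if "i < r" for i
        using l that by (auto simp: flip_sign_def P_def K_def)
      ultimately show ?thesis
        unfolding expand by (simp add: sum_negf)
    qed
    finally show ?thesis .
  qed
  have odd_sum: "(\<Sum>a\<in>{r..<r+s}. f a) = (\<Sum>a<r+s. f a)" if "\<And>a. a < r \<Longrightarrow> f a = 0"
    for f :: "nat \<Rightarrow> 'a"
    by (rule sum.mono_neutral_left) (use that in auto)
  show thesis
  proof
    fix b assume b: "r \<le> b" "b < r + s"
    have "(\<Sum>a\<in>{r..<r+s}. Q a * Y $$ (a,b)) = (\<Sum>a<r+s. Q a * Y $$ (a,b))"
      by (rule odd_sum) (simp add: Q_even)
    also have "\<dots> = (\<Sum>i\<in>K. W (basis_form {i}) K * (\<Sum>a<r+s. A $$ (i,a) * Y $$ (a,b)))"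
      unfolding Q_right sum_distrib_left sum_distrib_right
      by (subst sum.swap) (simp add: mult.assoc)
    also have "\<dots> = (\<Sum>i\<in>K. if i = b then W (basis_form {i}) K else 0)"
      by (rule sum.cong) (use l b in \<open>auto simp: K_def inverts_mat_sum[OF inv(1) carr Y]\<close>)
    also have "\<dots> = (if b = l then D else 0)"
      using b K D_l by (auto simp: K_def)
    finally show "(\<Sum>a\<in>{r..<r+s}. Q a * Y $$ (a,b)) =
        (if b = l then qdet (- inverse q) r (even_columns r A) else 0)"
      by (simp add: D_def \<mu>_def)
    \<comment> \<open>Extending \<open>Q\<close> by zero permits a sum over all \<open>a\<close>. By
      \<open>even\<close>, zero is given for \<open>a < r\<close> by the formula of
      \<open>odd\<close> with the entry in row \<open>l\<close> negated, which is the sign pattern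
      of the supertranspose identity.\<close>
    define E where "E = (\<lambda>a. if a < r then 0 else scale (\<mu> ^ r) (Q a))"
    have E: "E a = scale (\<mu> ^ r) ((if a < r then - A $$ (l,a) else A $$ (l,a)) * D) -
        (\<Sum>i<r. scale (\<mu> ^ i) (A $$ (i,a) * P i))" if "a < r + s" for a
    proof (cases "a < r")
      case True
      then show ?thesis using even[OF True] by (simp add: E_def add_eq_0_iff)
    next
      case False
      then show ?thesis using odd[of a] that by (simp add: E_def)
    qed
    have "scale (\<mu> ^ r) (\<Sum>a\<in>{r..<r+s}. Y $$ (a,b) * Q a) = (\<Sum>a\<in>{r..<r+s}. Y $$ (a,b) * E a)"
      unfolding scale_sum_right by (rule sum.cong) (auto simp: E_def mult_scale_right)
    also have "\<dots> = (\<Sum>a<r+s. Y $$ (a,b) * E a)"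
      by (rule odd_sum) (simp add: E_def)
    also have "\<dots> = (\<Sum>a<r+s. scale (\<mu> ^ r) (Y $$ (a,b) * (if a < r then - A $$ (l,a) else A $$ (l,a)) * D)
        - (\<Sum>i<r. scale (\<mu> ^ i) (Y $$ (a,b) * A $$ (i,a) * P i)))"
    proof (rule sum.cong[OF refl])
      fix a assume "a \<in> {..<r+s}"
      then have "a < r + s" by simp
      show "Y $$ (a,b) * E a = scale (\<mu> ^ r) (Y $$ (a,b) * (if a < r then - A $$ (l,a) else A $$ (l,a)) * D)
        - (\<Sum>i<r. scale (\<mu> ^ i) (Y $$ (a,b) * A $$ (i,a) * P i))"
        unfolding E[OF \<open>a < r + s\<close>] right_diff_distrib sum_distrib_left mult_scale_right mult.assoc ..
    qed
    also have "\<dots> = scale (\<mu> ^ r) ((\<Sum>a<r+s. Y $$ (a,b) * (if a < r then - A $$ (l,a) else A $$ (l,a))) * D)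
        - (\<Sum>i<r. scale (\<mu> ^ i) ((\<Sum>a<r+s. Y $$ (a,b) * A $$ (i,a)) * P i))"
      unfolding sum_subtractf scale_sum_right sum_distrib_right
      by (subst (2) sum.swap) (rule refl)
    also have "\<dots> = scale (\<mu> ^ r) (if b = l then D else 0)"
      unfolding supertranspose_inverts_odd_odd[OF inv(2) Y carr b l]
      by (simp add: supertranspose_inverts_odd_even[OF inv(2) Y carr b])
    finally show "(\<Sum>a\<in>{r..<r+s}. Y $$ (a,b) * Q a) =
        (if b = l then qdet (- inverse q) r (even_columns r A) else 0)"
      using \<mu> by (simp add: D_def \<mu>_def)
  qed
qed

text \<open>Solving the two systems for \<open>Q\<close> with the inverse \<open>S\<close> of the
  odd block gives \<open>d * S = Q = S * d\<close> entrywise; commuting with \<open>S\<close> passes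
  to its inverse \<open>D\<close>.\<close>

lemma qdet_even_commutes_odd:
  assumes A: "super_manin scale G q r s A" and q: "q \<noteq> 0"
    and Y: "Y \<in> carrier_mat (r+s) (r+s)"
    and inv: "inverts_mat A Y" "inverts_mat (supertranspose r Y) (supertranspose r A)"
    and gen: "generator_matrix scale G q' 0 s D"
    and D: "\<And>i j. i < s \<Longrightarrow> j < s \<Longrightarrow> D $$ (i,j) = Y $$ (r + i, r + j)"
    and ij: "i < s" "j < s"
  shows "qdet (- inverse q) r (even_columns r A) * Y $$ (r + i, r + j) =
    Y $$ (r + i, r + j) * qdet (- inverse q) r (even_columns r A)"
proof -
  define d where "d = qdet (- inverse q) r (even_columns r A)"
  define S where "S = minv D"
  have carr: "D \<in> carrier_mat s s" "S \<in> carrier_mat s s"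
    and DS: "inverts_mat D S" "inverts_mat S D" "inverts_mat (supertranspose 0 S) (supertranspose 0 D)"
    using gen by (auto simp: generator_matrix_def super_manin_def S_def)
  \<comment> \<open>In type \<open>0|s\<close> the supertranspose is the plain transpose. This
    contraction is the one that solves the second system.\<close>
  have SD: "(\<Sum>b<s. S $$ (b,c) * D $$ (a,b)) = (if c = a then 1 else 0)" if "a < s" "c < s" for a c
    using supertranspose_inverts_odd_odd[OF DS(3), of s c a] carr that by simp
  have shift: "(\<Sum>a\<in>{r..<r+s}. f a) = (\<Sum>a<s. f (r + a))" for f :: "nat \<Rightarrow> 'a"
    by (rule sum.reindex_bij_witness[of _ "\<lambda>a. r + a" "\<lambda>a. a - r"]) auto
  have comm: "d * S $$ (l,c) = S $$ (l,c) * d" if l: "l < s" and c: "c < s" for l c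
  proof -
    obtain Q where Q: "\<And>b. r \<le> b \<Longrightarrow> b < r + s \<Longrightarrow> (\<Sum>a\<in>{r..<r+s}. Q a * Y $$ (a,b)) = (if b = r + l then d else 0)"
      "\<And>b. r \<le> b \<Longrightarrow> b < r + s \<Longrightarrow> (\<Sum>a\<in>{r..<r+s}. Y $$ (a,b) * Q a) = (if b = r + l then d else 0)"
      using even_minors_with_odd_row[OF A q Y inv, of "r + l"] l unfolding d_def by auto
    have Q1: "(\<Sum>a<s. Q (r + a) * D $$ (a,b)) = (if b = l then d else 0)" if "b < s" for b
      using Q(1)[of "r + b"] that by (simp add: shift D)
    have Q2: "(\<Sum>a<s. D $$ (a,b) * Q (r + a)) = (if b = l then d else 0)" if "b < s" for b
      using Q(2)[of "r + b"] that by (simp add: shift D)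
    have "Q (r + c) = (\<Sum>a<s. Q (r + a) * (if a = c then 1 else 0))"
      using c by (simp add: if_distrib[of "\<lambda>x. _ * x"] cong: if_cong)
    also have "\<dots> = (\<Sum>a<s. Q (r + a) * (\<Sum>b<s. D $$ (a,b) * S $$ (b,c)))"
      by (rule sum.cong) (use c in \<open>auto simp: inverts_mat_sum[OF DS(1) carr]\<close>)
    also have "\<dots> = (\<Sum>b<s. (\<Sum>a<s. Q (r + a) * D $$ (a,b)) * S $$ (b,c))"
      unfolding sum_distrib_left sum_distrib_right by (subst sum.swap) (simp add: mult.assoc)
    also have "\<dots> = (\<Sum>b<s. if b = l then d * S $$ (b,c) else 0)"
      by (rule sum.cong) (auto simp: Q1)
    also have "\<dots> = d * S $$ (l,c)" using l by simp
    finally have 1: "Q (r + c) = d * S $$ (l,c)" .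
    have "Q (r + c) = (\<Sum>a<s. (if c = a then 1 else 0) * Q (r + a))"
      using c by (simp add: if_distrib[of "\<lambda>x. x * _"] cong: if_cong)
    also have "\<dots> = (\<Sum>a<s. (\<Sum>b<s. S $$ (b,c) * D $$ (a,b)) * Q (r + a))"
      by (rule sum.cong) (use c in \<open>auto simp: SD\<close>)
    also have "\<dots> = (\<Sum>b<s. S $$ (b,c) * (\<Sum>a<s. D $$ (a,b) * Q (r + a)))"
      unfolding sum_distrib_left sum_distrib_right by (subst sum.swap) (simp add: mult.assoc)
    also have "\<dots> = (\<Sum>b<s. if b = l then S $$ (b,c) * d else 0)"
      by (rule sum.cong) (auto simp: Q2)
    also have "\<dots> = S $$ (l,c) * d" using l by simp
    finally show ?thesis using 1 by simp
  qed
  \<comment> \<open>Insert \<open>D * S = 1\<close> in front, move \<open>d\<close> past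
    \<open>S\<close>, then contract \<open>S * D = 1\<close>.\<close>
  have "d * D $$ (i,j) = (\<Sum>c<s. (if i = c then 1 else 0) * (d * D $$ (c,j)))"
    using ij by (simp add: if_distrib[of "\<lambda>x. x * _"] cong: if_cong)
  also have "\<dots> = (\<Sum>c<s. (\<Sum>a<s. D $$ (i,a) * S $$ (a,c)) * (d * D $$ (c,j)))"
    by (rule sum.cong) (use ij in \<open>auto simp: inverts_mat_sum[OF DS(1) carr]\<close>)
  also have "\<dots> = (\<Sum>c<s. \<Sum>a<s. D $$ (i,a) * (d * S $$ (a,c)) * D $$ (c,j))"
    unfolding sum_distrib_right by (intro sum.cong refl) (simp add: comm mult.assoc)
  also have "\<dots> = (\<Sum>a<s. D $$ (i,a) * d * (\<Sum>c<s. S $$ (a,c) * D $$ (c,j)))"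
    unfolding sum_distrib_left by (subst sum.swap) (simp add: mult.assoc)
  also have "\<dots> = (\<Sum>a<s. if a = j then D $$ (i,a) * d else 0)"
    by (rule sum.cong) (use ij in \<open>auto simp: inverts_mat_sum[OF DS(2) carr(2,1)]\<close>)
  also have "\<dots> = D $$ (i,j) * d" using ij by simp
  finally show ?thesis using ij by (simp add: D d_def)
qed


section \<open>Berezinians as products of quantum determinants\<close>

lemma super_manin_carrier: "super_manin scale G q m n A \<Longrightarrow> A \<in> carrier_mat (m+n) (m+n)"
  unfolding super_manin_def by blast

lemma Ber_eq_qdet:
  "Ber scale q r s A = qdet (- inverse q) r (even_columns r A) * qdet (- inverse q) s (odd_rows r s (minv A))"
proof -
  have pw: "(- q) powi (- int k) = (- inverse q) ^ k" for k
    by (simp add: power_int_minus flip: power_inverse)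
  show ?thesis
    unfolding Ber_def qdet_def pw
    by (intro arg_cong2[where f = "(*)"] sum.cong refl arg_cong2[where f = scale]
          arg_cong[of _ _ prod_list] map_cong)
       (auto simp: even_columns_def odd_rows_def dest!: permutes_in_image)
qed

text \<open>For \<mu> = \<open>- inverse q\<close> the weights are powers of
  \<open>inverse \<mu>\<close> and the products are reversed, so \<open>qdet_reversed\<close> brings
  both factors back to \<mu>.\<close>

lemma Ber_supertranspose_flip_eq_qdet:
  assumes gen: "generator_matrix scale G (inverse q) r s A" and q: "q \<noteq> 0"
  shows "Ber scale (inverse q) s r (supertranspose s (flip_mat A)) =
    qdet (- inverse q) s (odd_rows r s A) * qdet (- inverse q) r (even_columns r (minv A))"
proof -
  have pw: "(- inverse q) powi (- int k) = inverse (- inverse q) ^ k" for k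
    by (simp add: power_int_minus flip: power_inverse)
  have A: "super_manin scale G (inverse q) r s A" "super_manin scale G q r s (minv A)"
    using gen by (auto simp: generator_matrix_def)
  have odd: "q_manin (- inverse q) {..<s} (odd_rows r s A)"
    unfolding odd_rows_def by (rule q_manin_odd_rows[OF A(1) q])
  have even: "q_manin (- inverse q) {..<r} (even_columns r (minv A))"
    unfolding even_columns_def by (rule q_manin_even_columns[OF A(2) q]) auto
  show ?thesis
    unfolding Ber_supertranspose_flip[OF gen] pw
      qdet_reversed[OF odd, symmetric, simplified neg_equal_0_iff_equal inverse_nonzero_iff_nonzero, OF q]
      qdet_reversed[OF even, symmetric, simplified neg_equal_0_iff_equal inverse_nonzero_iff_nonzero, OF q]
    by (intro arg_cong2[where f = "(*)"] sum.cong refl arg_cong2[where f = scale]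
          arg_cong[of _ _ prod_list] map_cong)
       (auto simp: even_columns_def odd_rows_def dest!: permutes_in_image)
qed

text \<open>The even determinant of \<open>M\<close> factors into that of its \<open>I\<close>-block
  and that of the inverse \<open>N\<close> of the \<open>J\<close>-block of \<open>minv M\<close>;
  the odd determinant is shared. The Berezinian of the flipped block has the odd factor first, so
  the last two must be interchanged.\<close>

lemma jacobi_even:
  assumes q: "q \<noteq> 0" and gen: "generator_matrix scale G q m n M"
    and I: "I \<subseteq> {..<m}" and J: "J = {..<m+n} - I"
    and genJ: "generator_matrix scale G (inverse q) (n_even m J) (n_odd m J) (submatrix (minv M) J J)"
    and genO: "generator_matrix scale G (inverse q) 0 n (submatrix (minv M) {m..<m+n} {m..<m+n})"
  shows "Ber scale q m n M =
    Ber scale q (n_even m I) (n_odd m I) (submatrix M I I)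
    * Ber scale (inverse q) (n_odd m J) (n_even m J)
        (supertranspose (n_odd m J) (flip_mat (submatrix (minv M) J J)))"
proof -
  define \<mu> where "\<mu> = - inverse q"
  have \<mu>: "\<mu> \<noteq> 0" using q by (simp add: \<mu>_def)
  define B where "B = minv M"
  define J0 where "J0 = {..<m} - I"
  define r where "r = card J0"
  define BJ where "BJ = submatrix B J J"
  define N where "N = minv BJ"
  define odd where "odd = {m..<m+n}"
  have fin: "finite I" "finite J0" "finite J" "finite odd"
    using I finite_subset by (auto simp: J J0_def odd_def)
  have JJ: "J = J0 \<union> odd" "J0 \<inter> odd = {}" using I by (auto simp: J J0_def odd_def)
  have n_I: "n_even m I = card I" "n_odd m I = 0"
    using I by (simp_all add: n_even_def n_odd_def Int_absorb2 Diff_eq_empty_iff[THEN iffD2])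
  have "J \<inter> {..<m} = J0" "J - {..<m} = odd" using I by (auto simp: J J0_def odd_def)
  then have n_J: "n_even m J = r" "n_odd m J = n"
    by (simp_all add: n_even_def n_odd_def r_def odd_def)
  have card_J: "card J = r + n"
    using JJ fin by (simp add: card_Un_disjoint r_def odd_def)
  have genJ: "generator_matrix scale G (inverse q) r n BJ"
    using genJ by (simp only: n_J BJ_def B_def)
  have manin_M: "super_manin scale G q m n M" and MB: "inverts_mat M B"
    and carr_M: "M \<in> carrier_mat (m+n) (m+n)" "B \<in> carrier_mat (m+n) (m+n)"
    using gen super_manin_carrier by (auto simp: generator_matrix_def B_def)
  have manin_N: "super_manin scale G q r n N" and N_BJ: "inverts_mat N BJ" "inverts_mat BJ N"
    "inverts_mat (supertranspose r BJ) (supertranspose r N)"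
    and carr_J: "BJ \<in> carrier_mat (card J) (card J)" "N \<in> carrier_mat (card J) (card J)"
    using genJ super_manin_carrier by (auto simp: generator_matrix_def N_def card_J)
  have BJ: "BJ $$ (rank J x, rank J y) = B $$ (x,y)" if "x \<in> J" "y \<in> J" for x y
    unfolding BJ_def rank_def by (rule submatrix_index_card) (use that carr_M J in auto)
  have rank_J0: "rank J x = rank J0 x" if "x \<in> J0" for x
    unfolding rank_def by (rule arg_cong[of _ _ card]) (use that in \<open>auto simp: JJ J0_def odd_def\<close>)
  have odd_J: "m + i \<in> J" if "i < n" for i using that by (simp add: JJ odd_def)
  have rank_odd: "rank J (m + i) = r + i" if "i < n" for i
  proof -
    have "{a \<in> J. a < m + i} = J0 \<union> {m..<m+i}" using that by (auto simp: JJ J0_def odd_def)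
    moreover have "J0 \<inter> {m..<m+i} = {}" by (auto simp: J0_def)
    ultimately show ?thesis using fin by (simp add: rank_def card_Un_disjoint r_def)
  qed
  define Z where "Z = even_columns m M"
  \<comment> \<open>The even determinant only sees rows below \<open>m\<close>, so only the even
    block of the Schur complement \<open>N\<close> is kept.\<close>
  define T where "T = (\<lambda>j i. if i \<in> J0 then N $$ (rank J i, rank J j) else 0)"
  have Z: "q_manin \<mu> {..<m} Z"
    unfolding Z_def even_columns_def \<mu>_def by (rule q_manin_even_columns[OF manin_M q]) auto
  have schur: "qdet \<mu> m Z = wedges \<mu> Z (sorted_list_of_set I) (basis_form {}) I *
      wedges \<mu> T (sorted_list_of_set J0) (basis_form {}) J0"
  proof (rule qdet_schur_right[OF Z \<mu>])
    fix j assume j: "j \<in> J0"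
    show "Z j = (\<lambda>i. T j i + (\<Sum>a\<in>I. Z a i * - (\<Sum>x\<in>J. B $$ (a,x) * N $$ (rank J x, rank J j))))"
    proof
      fix i
      show "Z j i = T j i + (\<Sum>a\<in>I. Z a i * - (\<Sum>x\<in>J. B $$ (a,x) * N $$ (rank J x, rank J j)))"
      proof (cases "i < m")
        case False
        then show ?thesis by (auto simp: Z_def even_columns_def T_def J0_def)
      next
        case True
        have U: "{..<m+n} - J = I" using I by (auto simp: J)
        have "M $$ (i,j) = (if i \<in> J then N $$ (rank J i, rank J j) else 0) +
            (\<Sum>a\<in>{..<m+n} - J. M $$ (i,a) * - (\<Sum>x\<in>J. B $$ (a,x) * N $$ (rank J x, rank J j)))"
        proof (rule schur_columns)
          fix y assume y: "y \<in> J"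
          have "(\<Sum>x\<in>J. B $$ (y,x) * N $$ (rank J x, rank J j)) =
              (\<Sum>x\<in>J. BJ $$ (rank J y, rank J x) * N $$ (rank J x, rank J j))"
            by (rule sum.cong) (use y in \<open>auto simp: BJ\<close>)
          then show "(\<Sum>x\<in>J. B $$ (y,x) * N $$ (rank J x, rank J j)) = (if y = j then 1 else 0)"
            using inverts_mat_rank_sum[OF N_BJ(2) carr_J fin(3) y, of j] j JJ by simp
        qed (use True j JJ J inverts_mat_sum[OF MB carr_M] in auto)
        moreover have "i \<in> J \<longleftrightarrow> i \<in> J0" using True by (auto simp: J J0_def)
        ultimately show ?thesis using True by (simp add: U Z_def T_def even_columns_def)
      qed
    qed
  qed (use I in \<open>auto simp: J0_def T_def\<close>)
  have det_I: "qdet \<mu> (card I) (even_columns (card I) (submatrix M I I)) =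
      wedges \<mu> Z (sorted_list_of_set I) (basis_form {}) I"
  proof (rule qdet_rank[OF fin(1)])
    fix j i assume ji: "j \<in> I" "i \<in> I"
    then have "submatrix M I I $$ (rank I i, rank I j) = M $$ (i,j)"
      unfolding rank_def by (intro submatrix_index_card) (use carr_M I in auto)
    then show "Z j i = even_columns (card I) (submatrix M I I) (rank I j) (rank I i)"
      using ji I rank_less_card[OF fin(1)] by (auto simp: Z_def even_columns_def)
  qed
  define d where "d = qdet \<mu> r (even_columns r N)"
  have det_N: "d = wedges \<mu> T (sorted_list_of_set J0) (basis_form {}) J0"
    unfolding d_def r_def
    by (rule qdet_rank[OF fin(2)])
       (auto simp: T_def even_columns_def rank_J0 rank_less_card[OF fin(2)])
  have "qdet \<mu> n (odd_rows r n BJ) = qdet \<mu> n (odd_rows m n B)"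
  proof (rule qdet_cong)
    fix j i assume ji: "j < n" "i < n"
    then have "BJ $$ (r + j, r + i) = B $$ (m + j, m + i)"
      using BJ[of "m + j" "m + i"] by (simp add: rank_odd odd_J)
    then show "odd_rows r n BJ j i = odd_rows m n B j i" using ji by (simp add: odd_rows_def)
  qed
  moreover have "d * qdet \<mu> n (odd_rows r n BJ) = qdet \<mu> n (odd_rows r n BJ) * d"
  proof (rule qdet_commute)
    fix j i assume ji: "j < n" "i < n"
    \<comment> \<open>Since \<open>J\<close> contains all odd indices, the odd block of
      \<open>BJ\<close> is that of \<open>B\<close>, to which \<open>genO\<close> applies.\<close>
    have "submatrix B odd odd $$ (x,y) = BJ $$ (r + x, r + y)" if "x < n" "y < n" for x y
    proof -
      have rk: "rank odd (m + z) = z" if "z < n" for z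
      proof -
        have "{a \<in> odd. a < m + z} = {m..<m+z}" using that by (auto simp: odd_def)
        then show ?thesis by (simp add: rank_def)
      qed
      have "submatrix B odd odd $$ (rank odd (m + x), rank odd (m + y)) = B $$ (m + x, m + y)"
        unfolding rank_def by (rule submatrix_index_card) (use that carr_M in \<open>auto simp: odd_def\<close>)
      then show ?thesis
        using BJ[of "m + x" "m + y"] that by (simp add: rk rank_odd odd_J)
    qed
    then show "d * odd_rows r n BJ j i = odd_rows r n BJ j i * d"
      using qdet_even_commutes_odd[OF manin_N q carr_J(1)[unfolded card_J] N_BJ(1,3)
          genO[folded B_def odd_def], of j i] ji
      by (simp add: odd_rows_def d_def \<mu>_def)
  qed
  moreover have "Ber scale q m n M = qdet \<mu> m Z * qdet \<mu> n (odd_rows m n B)"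
    by (simp add: Ber_eq_qdet \<mu>_def Z_def B_def)
  moreover have "Ber scale q (n_even m I) (n_odd m I) (submatrix M I I) =
      wedges \<mu> Z (sorted_list_of_set I) (basis_form {}) I"
    unfolding n_I Ber_eq_qdet \<mu>_def[symmetric] det_I by simp
  moreover have "Ber scale (inverse q) (n_odd m J) (n_even m J)
        (supertranspose (n_odd m J) (flip_mat (submatrix (minv M) J J))) =
      qdet \<mu> n (odd_rows r n BJ) * d"
    unfolding n_J B_def[symmetric] BJ_def[symmetric] d_def N_def \<mu>_def
    by (rule Ber_supertranspose_flip_eq_qdet[OF genJ q])
  ultimately show ?thesis by (simp add: schur det_N mult.assoc)
qed

text \<open>The even determinants of \<open>M\<close> and its \<open>I\<close>-block agree. The odd
  rows of \<open>minv M\<close> in \<open>I'\<close> are those of the inverse \<open>X\<close> up to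
  left combinations of rows in \<open>J'\<close>, and the odd determinant factors in the required
  order.\<close>

lemma jacobi_odd:
  assumes q: "q \<noteq> 0" and gen: "generator_matrix scale G q m n M"
    and I: "{..<m} \<subseteq> I" "I \<subseteq> {..<m+n}" and J: "J = {..<m+n} - I"
    and genI: "generator_matrix scale G q (n_even m I) (n_odd m I) (submatrix M I I)"
    and genJ: "generator_matrix scale G (inverse q) (n_even m J) (n_odd m J) (submatrix (minv M) J J)"
  shows "Ber scale q m n M =
    Ber scale q (n_even m I) (n_odd m I) (submatrix M I I)
    * Ber scale (inverse q) (n_odd m J) (n_even m J)
        (supertranspose (n_odd m J) (flip_mat (submatrix (minv M) J J)))"
proof -
  define \<mu> where "\<mu> = - inverse q"
  have \<mu>: "\<mu> \<noteq> 0" using q by (simp add: \<mu>_def)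
  define B where "B = minv M"
  \<comment> \<open>\<open>I'\<close> and \<open>J'\<close> are the odd indices of \<open>I\<close>
    and \<open>J\<close>, counted from 0.\<close>
  define I' where "I' = {i. m + i \<in> I}"
  define J' where "J' = {i. m + i \<in> J}"
  define MI where "MI = submatrix M I I"
  define X where "X = minv MI"
  define BJ where "BJ = submatrix B J J"
  have I'J': "I' \<union> J' = {..<n}" "I' \<inter> J' = {}" using I by (auto simp: I'_def J'_def J)
  then have fin: "finite I'" "finite J'" "finite I" "finite J"
    using finite_subset[OF I(2)] by (metis finite_Un finite_lessThan, metis finite_Un finite_lessThan, auto simp: J)
  have split: "S = S \<inter> {..<m} \<union> (+) m ` {i. m + i \<in> S}" for S :: "nat set"
    by (auto simp: image_iff) (metis le_add_diff_inverse not_less)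
  have "I \<inter> {..<m} = {..<m}" "J \<inter> {..<m} = {}" using I by (auto simp: J)
  then have II: "I = {..<m} \<union> (+) m ` I'" and JJ: "J = (+) m ` J'"
    using split[of I] split[of J] by (simp_all add: I'_def J'_def)
  have "I \<inter> {..<m} = {..<m}" "I - {..<m} = (+) m ` I'" "J \<inter> {..<m} = {}" "J - {..<m} = (+) m ` J'"
    by (auto simp: II JJ)
  then have nn: "n_even m I = m" "n_odd m I = card I'" "n_even m J = 0" "n_odd m J = card J'"
    by (simp_all add: n_even_def n_odd_def card_image)
  have card_I: "card I = m + card I'"
    unfolding II using fin by (subst card_Un_disjoint) (auto simp: card_image)
  have manin_B: "super_manin scale G (inverse q) m n B" and MB: "inverts_mat M B"
    and carr_M: "M \<in> carrier_mat (m+n) (m+n)" "B \<in> carrier_mat (m+n) (m+n)"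
    using gen super_manin_carrier by (auto simp: generator_matrix_def B_def)
  have XMI: "inverts_mat X MI" and carr_I: "X \<in> carrier_mat (card I) (card I)" "MI \<in> carrier_mat (card I) (card I)"
    using genI super_manin_carrier by (auto simp: generator_matrix_def X_def MI_def nn card_I)
  have genJ: "generator_matrix scale G (inverse q) 0 (card J') BJ"
    using genJ by (simp only: nn BJ_def B_def)
  have MI: "MI $$ (rank I x, rank I y) = M $$ (x,y)" if "x \<in> I" "y \<in> I" for x y
    unfolding MI_def rank_def by (rule submatrix_index_card) (use that carr_M I in auto)
  have BJ: "BJ $$ (rank J x, rank J y) = B $$ (x,y)" if "x \<in> J" "y \<in> J" for x y
    unfolding BJ_def rank_def by (rule submatrix_index_card) (use that carr_M J in auto)
  have rank_even: "rank I i = i" if "i < m" for i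
  proof -
    have "{a \<in> I. a < i} = {..<i}" using that by (auto simp: II)
    then show ?thesis by (simp add: rank_def)
  qed
  have rank_I: "rank I (m + i) = m + rank I' i" for i
  proof -
    have "{a \<in> I. a < m + i} = {..<m} \<union> (+) m ` {a \<in> I'. a < i}" by (auto simp: II)
    moreover have "card \<dots> = m + card {a \<in> I'. a < i}"
      using fin by (subst card_Un_disjoint) (auto simp: card_image)
    ultimately show ?thesis by (simp add: rank_def)
  qed
  have rank_J: "rank J (m + i) = rank J' i" for i
  proof -
    have "{a \<in> J. a < m + i} = (+) m ` {a \<in> J'. a < i}" by (auto simp: JJ)
    then show ?thesis by (simp add: rank_def card_image)
  qed
  define Z where "Z = odd_rows m n B"
  define T where "T = (\<lambda>j i. if i \<in> I' then X $$ (rank I (m + j), rank I (m + i)) else 0)"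
  have Z: "q_manin \<mu> {..<n} Z"
    unfolding Z_def odd_rows_def \<mu>_def by (rule q_manin_odd_rows[OF manin_B q])
  have schur: "qdet \<mu> n Z = wedges \<mu> T (sorted_list_of_set I') (basis_form {}) I' *
      wedges \<mu> Z (sorted_list_of_set J') (basis_form {}) J'"
  proof (rule qdet_schur_left[OF Z \<mu> I'J'])
    fix j assume j: "j \<in> I'"
    define c where "c = (\<lambda>a. - (\<Sum>x\<in>I. X $$ (rank I (m + j), rank I x) * M $$ (x,a)))"
    show "Z j = (\<lambda>i. T j i + (\<Sum>a\<in>J'. - (\<Sum>x\<in>I. X $$ (rank I (m + j), rank I x) * M $$ (x, m + a)) * Z a i))"
    proof
      fix i
      have "Z j i = T j i + (\<Sum>a\<in>J'. c (m + a) * Z a i)"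
      proof (cases "i < n")
        case False
        then show ?thesis using I'J' by (auto simp: Z_def odd_rows_def T_def)
      next
        case True
        \<comment> \<open>The complement of \<open>I\<close> is purely odd, so all correction terms
          are rows of the odd block.\<close>
        have U: "{..<m+n} - I = (+) m ` J'" using J JJ by simp
        have "B $$ (m + j, m + i) = (if m + i \<in> I then X $$ (rank I (m + j), rank I (m + i)) else 0) +
            (\<Sum>a\<in>{..<m+n} - I. c a * B $$ (a, m + i))"
          unfolding c_def
        proof (rule schur_rows)
          fix y assume y: "y \<in> I"
          have "(\<Sum>x\<in>I. X $$ (rank I (m + j), rank I x) * M $$ (x,y)) =
              (\<Sum>x\<in>I. X $$ (rank I (m + j), rank I x) * MI $$ (rank I x, rank I y))"
            by (rule sum.cong) (use y in \<open>auto simp: MI\<close>)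
          then show "(\<Sum>x\<in>I. X $$ (rank I (m + j), rank I x) * M $$ (x,y)) = (if m + j = y then 1 else 0)"
            using inverts_mat_rank_sum[OF XMI carr_I fin(3) _ y, of "m + j"] j by (simp add: I'_def)
        qed (use True j I I'_def inverts_mat_sum[OF MB carr_M] in auto)
        also have "(\<Sum>a\<in>{..<m+n} - I. c a * B $$ (a, m + i)) = (\<Sum>a\<in>J'. c (m + a) * B $$ (m + a, m + i))"
          unfolding U by (simp add: sum.reindex)
        finally show ?thesis using True by (simp add: Z_def T_def odd_rows_def I'_def)
      qed
      then show "Z j i = T j i + (\<Sum>a\<in>J'. - (\<Sum>x\<in>I. X $$ (rank I (m + j), rank I x) * M $$ (x, m + a)) * Z a i)"
        by (simp only: c_def)
    qed
  qed (use I'J' in \<open>auto simp: T_def\<close>)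
  have even: "qdet \<mu> m (even_columns m MI) = qdet \<mu> m (even_columns m M)"
  proof (rule qdet_cong)
    fix j i assume ji: "j < m" "i < m"
    then have "MI $$ (i,j) = M $$ (i,j)" using MI[of i j] I by (auto simp: rank_even)
    then show "even_columns m MI j i = even_columns m M j i" by (simp add: even_columns_def)
  qed
  have odd_I: "qdet \<mu> (card I') (odd_rows m (card I') X) =
      wedges \<mu> T (sorted_list_of_set I') (basis_form {}) I'"
    by (rule qdet_rank[OF fin(1)]) (auto simp: T_def odd_rows_def rank_I rank_less_card[OF fin(1)])
  have odd_J: "qdet \<mu> (card J') (odd_rows 0 (card J') BJ) =
      wedges \<mu> Z (sorted_list_of_set J') (basis_form {}) J'"
  proof (rule qdet_rank[OF fin(2)])
    fix j i assume ji: "j \<in> J'" "i \<in> J'"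
    then have "BJ $$ (rank J' j, rank J' i) = B $$ (m + j, m + i)"
      using BJ[of "m + j" "m + i"] by (simp add: rank_J J'_def)
    then show "Z j i = odd_rows 0 (card J') BJ (rank J' j) (rank J' i)"
      using ji I'J' rank_less_card[OF fin(2)] by (auto simp: Z_def odd_rows_def)
  qed
  have "Ber scale q m n M = qdet \<mu> m (even_columns m M) * qdet \<mu> n Z"
    by (simp add: Ber_eq_qdet \<mu>_def Z_def B_def)
  moreover have "Ber scale q (n_even m I) (n_odd m I) (submatrix M I I) =
      qdet \<mu> m (even_columns m M) * wedges \<mu> T (sorted_list_of_set I') (basis_form {}) I'"
    unfolding nn Ber_eq_qdet \<mu>_def[symmetric] MI_def[symmetric] X_def[symmetric] even odd_I ..
  moreover have "Ber scale (inverse q) (n_odd m J) (n_even m J)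
        (supertranspose (n_odd m J) (flip_mat (submatrix (minv M) J J))) =
      wedges \<mu> Z (sorted_list_of_set J') (basis_form {}) J'"
    unfolding nn B_def[symmetric] BJ_def[symmetric] Ber_supertranspose_flip_eq_qdet[OF genJ q]
      \<mu>_def[symmetric] odd_J by simp
  ultimately show ?thesis by (simp add: schur mult.assoc)
qed

end

theorem theorem4p4:
  fixes scale :: "'k::field \<Rightarrow> 'a::ring_1 \<Rightarrow> 'a" and G :: "nat \<Rightarrow> 'a set"
    and q :: 'k and m n :: nat and M :: "'a mat" and I J :: "nat set"
  assumes "superalgebra scale G"
    and "q \<noteq> 0"
    and "generator_matrix scale G q m n M"
    and "I \<subseteq> {..<m+n}" and "J = {..<m+n} - I"
    and "regular_at scale G q m n M I"
    and "regular_at scale G q m n M {..<m}"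
    and "I \<subseteq> {..<m} \<or> {..<m} \<subseteq> I"
  shows "Ber scale q m n M =
    Ber scale q (n_even m I) (n_odd m I) (submatrix M I I)
    * Ber scale (inverse q) (n_odd m J) (n_even m J)
        (supertranspose (n_odd m J) (flip_mat (submatrix (minv M) J J)))"
proof -
  interpret superalgebra scale G by (rule assms(1))
  have genI: "generator_matrix scale G q (n_even m I) (n_odd m I) (submatrix M I I)"
    and genJ: "generator_matrix scale G (inverse q) (n_even m J) (n_odd m J) (submatrix (minv M) J J)"
    using assms(5,6) by (simp_all add: regular_at_def Let_def)
  \<comment> \<open>Regularity at \<open>{..<m}\<close> makes the full odd block of
    \<open>minv M\<close> a generator matrix of type \<open>0|n\<close>.\<close>
  have odd: "{..<m+n} - {..<m} = {m..<m+n}" by auto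
  have "n_even m {m..<m+n} = 0" "n_odd m {m..<m+n} = n"
  proof -
    have "{m..<m+n} \<inter> {..<m} = {}" "{m..<m+n} - {..<m} = {m..<m+n}" by auto
    then show "n_even m {m..<m+n} = 0" "n_odd m {m..<m+n} = n"
      by (simp_all add: n_even_def n_odd_def)
  qed
  then have genO: "generator_matrix scale G (inverse q) 0 n (submatrix (minv M) {m..<m+n} {m..<m+n})"
    using assms(7) by (simp add: regular_at_def Let_def odd)
  from assms(8) show ?thesis
  proof
    assume "I \<subseteq> {..<m}"
    then show ?thesis by (rule jacobi_even[OF assms(2,3) _ assms(5) genJ genO])
  next
    assume "{..<m} \<subseteq> I"
    then show ?thesis by (rule jacobi_odd[OF assms(2,3) _ assms(4,5) genI genJ])
  qed
qed

end
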